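(* Let $\mathbb F=\mathbb C$ or $\mathbb R$, and let $t\ge 1$. (a) Let $\mathcal A=(A_1,\dots,A_t)$, with linear mappings $A_i:\mathbb F^{m_i}\to\mathbb F^{m_{i+1}}$ for $1\le i\le t-1$ and $A_t:\mathbb F^{m_t}\to\mathbb F^{m_1}$, and $\mathcal B=(B_1,\dots,B_t)$, with linear mappings $B_i:\mathbb F^{n_i}\to\mathbb F^{n_{i+1}}$ for $1\le i\le t-1$ and $B_t:\mathbb F^{n_t}\to\mathbb F^{n_1}$, be topologically equivalent oriented cycles of linear mappings over $\mathbb F$ of length $t$. Let $$\mathcal A=\mathcal A_{\mathrm{reg}}\oplus \mathcal A_1\oplus\dots\oplus\mathcal A_r,\qquad \mathcal B=\mathcal B_{\mathrm{reg}}\oplus\mathcal B_1\oplus\dots\oplus\mathcal B_s$$ be regularizing decompositions of them (that is, $\mathcal A_{\mathrm{reg}}$ and $\mathcal B_{\mathrm{reg}}$ are regular and all $\mathcal A_i$, $\mathcal B_j$ are indecomposable singular). Then the regular parts $\mathcal A_{\mathrm{reg}}$ and $\mathcal B_{\mathrm{reg}}$ are topologically equivalent, $r=s$, and after a suitable renumbering the indecomposable singular summands $\mathcal A_i$ and $\mathcal B_i$ are isomorphic for all $i=1,\dots,r$. (b) Each regular oriented cycle $\mathcal A=(A_1,\dots,A_t)$ of linear mappings $A_i:\mathbb F^{m_i}\to\mathbb F^{m_{i+1}}$ $(1\le i\le t-1)$, $A_t:\mathbb F^{m_t}\to\mathbb F^{m_1}$ (so that $m_1=\dots=m_t$) is isomorphic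 to the cycle $$\mathcal A'=(\mathbb 1,\dots,\mathbb 1,\;A_t\cdots A_2A_1)$$ on the same spaces, in which the mappings $\mathbb F^{m_i}\to\mathbb F^{m_{i+1}}$ for $1\le i\le t-1$ are the identity $\mathbb 1$ and the mapping $\mathbb F^{m_t}\to\mathbb F^{m_1}$ is $A_t\cdots A_2A_1$. Moreover, if $\mathcal A=(A_1,\dots,A_t)$ on $\mathbb F^{m_1},\dots,\mathbb F^{m_t}$ and $\mathcal B=(B_1,\dots,B_t)$ on $\mathbb F^{n_1},\dots,\mathbb F^{n_t}$ are regular oriented cycles of length $t$, then they are topologically equivalent if and only if the linear operators $A_t\cdots A_2A_1:\mathbb F^{m_1}\to\mathbb F^{m_1}$ and $B_t\cdots B_2B_1:\mathbb F^{n_1}\to\mathbb F^{n_1}$ are topologically equivalent as cycles of length $1$ (that is, there is a homeomorphism $\varphi:\mathbb F^{m_1}\to\mathbb F^{n_1}$ with $\varphi\, A_t\cdots A_2A_1=B_t\cdots B_2B_1\,\varphi$).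
   Context: An oriented cycle of linear mappings of length $t\ge 1$ over a field $\mathbb F$ is a system $\mathcal A$ of finite-dimensional vector spaces $V_1,\dots,V_t$ over $\mathbb F$ and linear mappings $A_i:V_i\to V_{i+1}$ $(1\le i\le t-1)$ and $A_t:V_t\to V_1$. (For $t=1$ it is a linear operator $A_1:V_1\to V_1$.) Let $\mathcal B$ be another such cycle of the same length $t$, with spaces $W_1,\dots,W_t$ and mappings $B_1,\dots,B_t$. A system of bijections $\varphi_i:V_i\to W_i$ $(i=1,\dots,t)$ transforms $\mathcal A$ to $\mathcal B$ if $\varphi_{i+1}A_i=B_i\varphi_i$ for $1\le i\le t-1$ and $\varphi_1A_t=B_t\varphi_t$. $\mathcal A$ and $\mathcal B$ are isomorphic if some system of linear bijections transforms $\mathcal A$ to $\mathcal B$. When $\mathbb F=\mathbb C$ or $\mathbb R$, $V_i=\mathbb F^{m_i}$ and $W_i=\mathbb F^{n_i}$, they are topologically equivalent if some system of homeomorphisms (not necessarily linear) transforms $\mathcal A$ to $\mathcal B$. The same definition is used when the $V_i,W_i$ are arbitrary finite-dimensional vector spaces over $\mathbb F$ with their usual topology (equivalently, after identifying them with spaces $\mathbb F^{m}$ by choosing bases). The direct sum $\mathcal A\oplus\mathcal B$ is the cycle with spaces $V_i\oplus W_i$ and mappings $A_i\oplus B_i$. The dimension of $\mathcal A$ is the vector $(\dim V_1,\dots,\dim V_t)$. A cycle is indecomposable if its dimension is nonzero and it cannot be decomposed into a direct sum of cycles of smaller dimensions (i.e. of two cycles both of nonzero dimension). A cycle is regular if all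 its mappings $A_1,\dots,A_t$ are bijections, and singular otherwise. A regularizing decomposition of $\mathcal A$ is a decomposition $\mathcal A=\mathcal A_{\mathrm{reg}}\oplus\mathcal A_1\oplus\dots\oplus\mathcal A_r$ in which $\mathcal A_{\mathrm{reg}}$ is regular (possibly of zero dimension), $r\ge 0$, and $\mathcal A_1,\dots,\mathcal A_r$ are indecomposable singular cycles; every cycle has one. *)

theory Defs
  imports "HOL-Analysis.Analysis" "HOL-Library.Function_Algebras"
begin

text \<open>
  Finite-dimensional vector spaces over the field \<open>'a\<close> are represented as
  finite-dimensional linear subspaces of a function space \<open>'i \<Rightarrow> 'a\<close> with an arbitrary
  coordinate index type \<open>'i\<close>. The subspace topology inherited from the product topology on
  \<open>'i \<Rightarrow> 'a\<close> is then the usual topology of a finite-dimensional space when \<open>'a\<close> is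
  the reals or the complex numbers.
\<close>

definition fscale :: "'a::real_normed_field \<Rightarrow> ('i \<Rightarrow> 'a) \<Rightarrow> 'i \<Rightarrow> 'a" where
  "fscale c x = (\<lambda>i. c * x i)"

interpretation fun_vs: vector_space "fscale :: 'a::real_normed_field \<Rightarrow> ('i \<Rightarrow> 'a) \<Rightarrow> 'i \<Rightarrow> 'a"
  by unfold_locales (auto simp: fscale_def algebra_simps)

definition coord_space :: "nat \<Rightarrow> (nat \<Rightarrow> 'a::real_normed_field) set" where
  "coord_space m = {x. \<forall>j\<ge>m. x j = 0}"

definition fin_dim_space :: "('i \<Rightarrow> 'a::real_normed_field) set \<Rightarrow> bool" where
  "fin_dim_space V \<longleftrightarrow> (\<exists>B. finite B \<and> fun_vs.span B = V)"

definition linear_map_on ::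
  "('i \<Rightarrow> 'a::real_normed_field) set \<Rightarrow> ('j \<Rightarrow> 'a) set \<Rightarrow> (('i \<Rightarrow> 'a) \<Rightarrow> 'j \<Rightarrow> 'a) \<Rightarrow> bool" where
  "linear_map_on V W f \<longleftrightarrow> f \<in> V \<rightarrow> W \<and>
     (\<forall>x\<in>V. \<forall>y\<in>V. f (x + y) = f x + f y) \<and>
     (\<forall>c. \<forall>x\<in>V. f (fscale c x) = fscale c (f x))"

text \<open>
  A cycle of length \<open>t\<close> has vertices \<open>1, \<dots>, t\<close>. The fields below matter only at the
  indices \<open>1, \<dots>, t\<close>, and the map at index \<open>i\<close> matters only on the space at \<open>i\<close>;
  all notions that follow ignore the other values.
\<close>

record ('i, 'a) lcycle =
  spc :: "nat \<Rightarrow> ('i \<Rightarrow> 'a) set"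
  mp :: "nat \<Rightarrow> ('i \<Rightarrow> 'a) \<Rightarrow> 'i \<Rightarrow> 'a"

definition next_vertex :: "nat \<Rightarrow> nat \<Rightarrow> nat" where
  "next_vertex t i = (if i = t then 1 else Suc i)"

definition lin_cycle :: "nat \<Rightarrow> ('i, 'a::real_normed_field) lcycle \<Rightarrow> bool" where
  "lin_cycle t A \<longleftrightarrow> (\<forall>i\<in>{1..t}. fin_dim_space (spc A i) \<and>
     linear_map_on (spc A i) (spc A (next_vertex t i)) (mp A i))"

definition coord_cycle :: "nat \<Rightarrow> (nat \<Rightarrow> nat) \<Rightarrow> (nat, 'a::real_normed_field) lcycle \<Rightarrow> bool" where
  "coord_cycle t m A \<longleftrightarrow> lin_cycle t A \<and> (\<forall>i\<in>{1..t}. spc A i = coord_space (m i))"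

definition transforms ::
  "nat \<Rightarrow> (nat \<Rightarrow> ('i \<Rightarrow> 'a) \<Rightarrow> 'j \<Rightarrow> 'a) \<Rightarrow> ('i, 'a::real_normed_field) lcycle \<Rightarrow> ('j, 'a) lcycle \<Rightarrow> bool" where
  "transforms t \<phi> A B \<longleftrightarrow> (\<forall>i\<in>{1..t}. bij_betw (\<phi> i) (spc A i) (spc B i) \<and>
     (\<forall>x\<in>spc A i. \<phi> (next_vertex t i) (mp A i x) = mp B i (\<phi> i x)))"

definition isomorphic_cycles ::
  "nat \<Rightarrow> ('i, 'a::real_normed_field) lcycle \<Rightarrow> ('j, 'a) lcycle \<Rightarrow> bool" where
  "isomorphic_cycles t A B \<longleftrightarrow>
     (\<exists>\<phi>. transforms t \<phi> A B \<and> (\<forall>i\<in>{1..t}. linear_map_on (spc A i) (spc B i) (\<phi> i)))"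

definition top_equiv_cycles ::
  "nat \<Rightarrow> ('i, 'a::real_normed_field) lcycle \<Rightarrow> ('j, 'a) lcycle \<Rightarrow> bool" where
  "top_equiv_cycles t A B \<longleftrightarrow>
     (\<exists>\<phi>. transforms t \<phi> A B \<and> (\<forall>i\<in>{1..t}. \<exists>\<psi>. homeomorphism (spc A i) (spc B i) (\<phi> i) \<psi>))"

text \<open>
  External direct sums: coordinates are indexed by the disjoint union of the coordinate index
  types, respectively (for a family indexed by \<open>1, \<dots>, r\<close>) by pairs of a summand number and a
  coordinate of that summand.
\<close>

definition dsum :: "('i, 'a::real_normed_field) lcycle \<Rightarrow> ('j, 'a) lcycle \<Rightarrow> ('i + 'j, 'a) lcycle" where
  "dsum A B =
     \<lparr>spc = \<lambda>i. {x. (\<lambda>j. x (Inl j)) \<in> spc A i \<and> (\<lambda>j. x (Inr j)) \<in> spc B i},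
      mp = \<lambda>i x. case_sum (mp A i (\<lambda>j. x (Inl j))) (mp B i (\<lambda>j. x (Inr j)))\<rparr>"

definition dsum_family ::
  "nat \<Rightarrow> (nat \<Rightarrow> ('i, 'a::real_normed_field) lcycle) \<Rightarrow> (nat \<times> 'i, 'a) lcycle" where
  "dsum_family r S =
     \<lparr>spc = \<lambda>i. {x. (\<forall>k\<in>{1..r}. (\<lambda>j. x (k, j)) \<in> spc (S k) i) \<and>
                    (\<forall>k j. k \<notin> {1..r} \<longrightarrow> x (k, j) = 0)},
      mp = \<lambda>i x (k, j). if k \<in> {1..r} then mp (S k) i (\<lambda>j. x (k, j)) j else 0\<rparr>"

definition nonzero_dim :: "nat \<Rightarrow> ('i, 'a::real_normed_field) lcycle \<Rightarrow> bool" where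
  "nonzero_dim t A \<longleftrightarrow> (\<exists>i\<in>{1..t}. fun_vs.dim (spc A i) \<noteq> 0)"

text \<open>
  Decomposing a cycle into a direct sum means being isomorphic to an external direct sum.
  Restricting the summands to the index type \<open>nat\<close> loses nothing, since every
  finite-dimensional space is isomorphic to a subspace of \<open>nat \<Rightarrow> 'a\<close>.
\<close>

definition indecomposable_cycle :: "nat \<Rightarrow> ('i, 'a::real_normed_field) lcycle \<Rightarrow> bool" where
  "indecomposable_cycle t A \<longleftrightarrow> nonzero_dim t A \<and>
     \<not> (\<exists>(B :: (nat, 'a) lcycle) (C :: (nat, 'a) lcycle).
          lin_cycle t B \<and> lin_cycle t C \<and> nonzero_dim t B \<and> nonzero_dim t C \<and>
          isomorphic_cycles t A (dsum B C))"

definition regular_cycle :: "nat \<Rightarrow> ('i, 'a::real_normed_field) lcycle \<Rightarrow> bool" where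
  "regular_cycle t A \<longleftrightarrow>
     (\<forall>i\<in>{1..t}. bij_betw (mp A i) (spc A i) (spc A (next_vertex t i)))"

abbreviation singular_cycle :: "nat \<Rightarrow> ('i, 'a::real_normed_field) lcycle \<Rightarrow> bool" where
  "singular_cycle t A \<equiv> \<not> regular_cycle t A"

definition regularizing_decomposition ::
  "nat \<Rightarrow> ('i, 'a::real_normed_field) lcycle \<Rightarrow> ('j, 'a) lcycle \<Rightarrow> nat \<Rightarrow>
   (nat \<Rightarrow> ('k, 'a) lcycle) \<Rightarrow> bool" where
  "regularizing_decomposition t A R r S \<longleftrightarrow>
     lin_cycle t R \<and> regular_cycle t R \<and>
     (\<forall>k\<in>{1..r}. lin_cycle t (S k) \<and> indecomposable_cycle t (S k) \<and> singular_cycle t (S k)) \<and>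
     isomorphic_cycles t A (dsum R (dsum_family r S))"

primrec map_product :: "(nat \<Rightarrow> 'v \<Rightarrow> 'v) \<Rightarrow> nat \<Rightarrow> 'v \<Rightarrow> 'v" where
  "map_product f 0 = id"
| "map_product f (Suc k) = f (Suc k) \<circ> map_product f k"

definition normal_cycle :: "nat \<Rightarrow> ('i, 'a::real_normed_field) lcycle \<Rightarrow> ('i, 'a) lcycle" where
  "normal_cycle t A =
     \<lparr>spc = spc A, mp = \<lambda>i. if i = t then map_product (mp A) t else id\<rparr>"

definition operator_cycle ::
  "('i \<Rightarrow> 'a::real_normed_field) set \<Rightarrow> (('i \<Rightarrow> 'a) \<Rightarrow> 'i \<Rightarrow> 'a) \<Rightarrow> ('i, 'a) lcycle" where
  "operator_cycle V f = \<lparr>spc = \<lambda>_. V, mp = \<lambda>_. f\<rparr>"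

end

theory Submission
  imports Defs "HOL-Homology.Invariance_of_Domain"
begin

text \<open>
  A homeomorphism that transforms one cycle into another need not be linear, but it maps the image
  of every composite of consecutive mappings (a \<open>walk\<close>) onto the image of the corresponding walk of
  the other cycle. Both parts of the theorem rest on this.

  The images of walks that are long enough are the regular part of the cycle. So the
  transformation restricts to a topological equivalence of the regular parts
  (\<open>regular_part_top_equiv\<close>). The dimensions of the images of all walks are topological
  invariants by Brouwer's invariance of dimension (\<open>card_ends_invariant\<close>), and it remains to see
  that they determine the singular summands up to isomorphism.

  By Fitting's lemma all composites that are long enough vanish on an indecomposable singular
  cycle (\<open>indecomposable_singular_nilpotent\<close>). Such a cycle is a \<open>string\<close>: it has a basis
  \<open>e\<^sub>0, e\<^sub>1, \<dots>\<close> in which the mappings send each basis vector to the next one and the last one to zero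
  (\<open>indecomposable_nilpotent_string\<close>). Up to isomorphism a string is given by its first vertex and
  its length. In a sum of a regular cycle and strings, the dimension of the image of an \<open>n\<close>-step walk
  from vertex \<open>i\<close> is the dimension of the regular part plus the number of basis vectors at \<open>i\<close> that
  have at least \<open>n\<close> successors. From these numbers one recovers how many strings there are with
  each first vertex and each length by taking differences twice (\<open>card_strings_eq\<close>).

  For a regular cycle the partial products \<open>A\<^sub>i \<dots> A\<^sub>1\<close> are bijections of the first space onto the
  other ones; using them as coordinate changes leaves the full product as the only mapping that is
  not the identity (\<open>isomorphic_normal_cycle\<close>).

  All spaces are subspaces of function spaces. Their topology is controlled by pivot coordinates
  (\<open>pivots_exist\<close>): on a finite-dimensional subspace, finitely many evaluations form a linear
  coordinate system. Real and complex scalars are treated together as normed fields that are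
  Euclidean spaces over the reals.
\<close>

section \<open>Finite-dimensional subspaces of function spaces\<close>

lemma sum_fun_apply: "(\<Sum>j\<in>J. f j) i = (\<Sum>j\<in>J. f j i)"
  by (induction J rule: infinite_finite_induct) auto

lemma fscale_apply: "fscale c x i = c * x i"
  by (simp add: fscale_def)

lemma fin_dim_space_subspace: "fin_dim_space V \<Longrightarrow> fun_vs.subspace V"
  by (auto simp: fin_dim_space_def)

lemma fin_dim_space_subset:
  assumes V: "fin_dim_space V" and U: "fun_vs.subspace U" "U \<subseteq> V"
  shows "fin_dim_space U"
proof -
  obtain B where B: "finite B" "fun_vs.span B = V"
    using V by (auto simp: fin_dim_space_def)
  obtain C where C: "C \<subseteq> U" "fun_vs.independent C" "U \<subseteq> fun_vs.span C"
    using fun_vs.basis_exists by metis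
  have "finite C"
    using fun_vs.independent_span_bound[OF B(1) C(2)] C(1) U(2) B(2) by auto
  moreover have "fun_vs.span C = U"
    using C U(1) by (simp add: fun_vs.span_minimal subset_antisym)
  ultimately show ?thesis by (auto simp: fin_dim_space_def)
qed

lemma fin_dim_space_basis:
  assumes "fin_dim_space V"
  obtains C where "finite C" "C \<subseteq> V" "fun_vs.independent C" "fun_vs.span C = V"
    "card C = fun_vs.dim V"
proof -
  obtain B where B: "finite B" "fun_vs.span B = V"
    using assms by (auto simp: fin_dim_space_def)
  obtain C where C: "C \<subseteq> V" "fun_vs.independent C" "V \<subseteq> fun_vs.span C" "card C = fun_vs.dim V"
    using fun_vs.basis_exists by metis
  have "finite C"
    using fun_vs.independent_span_bound[OF B(1) C(2)] C(1) B(2) by auto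
  moreover have "fun_vs.span C = V"
    using C fin_dim_space_subspace[OF assms] by (simp add: fun_vs.span_minimal subset_antisym)
  ultimately show ?thesis using that C by auto
qed

lemma dim_eq_0_iff:
  assumes "fin_dim_space V"
  shows "fun_vs.dim V = 0 \<longleftrightarrow> V = {0}"
proof
  obtain C where C: "finite C" "fun_vs.span C = V" "card C = fun_vs.dim V"
    using fin_dim_space_basis[OF assms] by metis
  show "V = {0}" if "fun_vs.dim V = 0"
    using C that by auto
  show "fun_vs.dim V = 0" if "V = {0}"
    using that fun_vs.dim_le_card[of V "{}"] by simp
qed

lemma dim_strict_mono:
  assumes W: "fin_dim_space W" and U: "fun_vs.subspace U" "U \<subset> W"
  shows "fun_vs.dim U < fun_vs.dim W"
proof -
  obtain C where C: "finite C" "C \<subseteq> U" "fun_vs.independent C" "fun_vs.span C = U"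
      "card C = fun_vs.dim U"
    using fin_dim_space_basis[OF fin_dim_space_subset[OF W U(1)]] U(2) by blast
  obtain B where B: "finite B" "fun_vs.span B = W" "card B = fun_vs.dim W"
    using fin_dim_space_basis[OF W] by metis
  obtain x where x: "x \<in> W" "x \<notin> U" using U(2) by blast
  have "fun_vs.independent (insert x C)"
    using C x by (simp add: fun_vs.independent_insert)
  moreover have "insert x C \<subseteq> fun_vs.span B" using x C B U by auto
  ultimately have "card (insert x C) \<le> card B"
    using fun_vs.independent_span_bound[OF B(1)] by blast
  moreover have "x \<notin> C" using C x by auto
  ultimately show ?thesis using B C by simp
qed

text \<open>Both chain conditions come from the dimension, a bounded natural number that changes
  strictly at each strict inclusion.\<close>

lemma decreasing_chain_stable:
  fixes U :: "nat \<Rightarrow> ('i \<Rightarrow> 'a::real_normed_field) set"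
  assumes "\<And>n. fin_dim_space (U n)" "\<And>n. U (Suc n) \<subseteq> U n"
  shows "\<exists>N. \<forall>n\<ge>N. U n = U N"
proof -
  define N where "N = (ARG_MIN (\<lambda>n. fun_vs.dim (U n)) n. True)"
  have min: "fun_vs.dim (U N) \<le> fun_vs.dim (U n)" for n
    unfolding N_def by (rule arg_min_nat_le) simp
  have "U n = U N" if "n \<ge> N" for n
  proof (rule ccontr)
    assume "U n \<noteq> U N"
    moreover have "U n \<subseteq> U N" using lift_Suc_antimono_le[of U N n] assms(2) that by auto
    ultimately show False
      using dim_strict_mono[OF assms(1), of "U n" N] min[of n]
        fin_dim_space_subspace[OF assms(1)] by force
  qed
  then show ?thesis by blast
qed

lemma increasing_chain_stable:
  fixes U :: "nat \<Rightarrow> ('i \<Rightarrow> 'a::real_normed_field) set"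
  assumes V: "fin_dim_space V" and U: "\<And>n. fun_vs.subspace (U n)" "\<And>n. U n \<subseteq> V"
    and inc: "\<And>n. U n \<subseteq> U (Suc n)"
  shows "\<exists>N. \<forall>n\<ge>N. U n = U N"
proof -
  have fin: "fin_dim_space (U n)" for n using fin_dim_space_subset[OF V] U by blast
  have bound: "fun_vs.dim (U n) \<le> fun_vs.dim V" for n
    using dim_strict_mono[OF V U(1), of n] U(2)[of n] by (cases "U n = V") (auto simp: psubset_eq intro: less_imp_le)
  define N where "N = (ARG_MIN (\<lambda>n. fun_vs.dim V - fun_vs.dim (U n)) n. True)"
  have min: "fun_vs.dim V - fun_vs.dim (U N) \<le> fun_vs.dim V - fun_vs.dim (U n)" for n
    unfolding N_def by (rule arg_min_nat_le) simp
  have "U n = U N" if "n \<ge> N" for n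
  proof (rule ccontr)
    assume "U n \<noteq> U N"
    moreover have "U N \<subseteq> U n" using lift_Suc_mono_le[of U N n] inc that by auto
    ultimately show False
      using dim_strict_mono[OF fin U(1), of N n] min[of n] bound[of n] bound[of N] by force
  qed
  then show ?thesis by blast
qed

section \<open>Linear maps between subspaces\<close>

lemma linear_map_onD:
  assumes "linear_map_on V W f"
  shows "x \<in> V \<Longrightarrow> f x \<in> W" "x \<in> V \<Longrightarrow> y \<in> V \<Longrightarrow> f (x + y) = f x + f y"
    "x \<in> V \<Longrightarrow> f (fscale c x) = fscale c (f x)"
  using assms by (auto simp: linear_map_on_def)

lemma linear_map_on_zero: "linear_map_on V W f \<Longrightarrow> fun_vs.subspace V \<Longrightarrow> f 0 = 0"
  using linear_map_onD(3)[of V W f 0 0] fun_vs.subspace_0[of V] by simp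

lemma linear_map_on_diff:
  assumes f: "linear_map_on V W f" "fun_vs.subspace V" and xy: "x \<in> V" "y \<in> V"
  shows "f (x - y) = f x - f y"
proof -
  have "x = (x - y) + y" by simp
  then have "f x = f (x - y) + f y"
    using linear_map_onD(2)[OF f(1) fun_vs.subspace_diff[OF f(2) xy] xy(2)] by metis
  then show ?thesis by simp
qed

lemma linear_map_on_sum:
  assumes f: "linear_map_on V W f" "fun_vs.subspace V" and x: "\<And>j. j \<in> J \<Longrightarrow> x j \<in> V"
  shows "f (\<Sum>j\<in>J. x j) = (\<Sum>j\<in>J. f (x j))"
  using x
proof (induction J rule: infinite_finite_induct)
  case (insert j J)
  have "f (x j + sum x J) = f (x j) + f (sum x J)"
    using insert.prems by (intro linear_map_onD(2)[OF f(1)] fun_vs.subspace_sum[OF f(2)]) auto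
  also have "x j + sum x J = sum x (insert j J)"
    using insert.hyps by (rule sum.insert[symmetric])
  also have "f (sum x J) = (\<Sum>j\<in>J. f (x j))" using insert by simp
  also have "f (x j) + \<dots> = (\<Sum>j\<in>insert j J. f (x j))"
    using insert.hyps by (rule sum.insert[symmetric])
  finally show ?case .
qed (auto simp: linear_map_on_zero[OF f])

lemma linear_map_on_comp:
  "linear_map_on U V f \<Longrightarrow> linear_map_on V W g \<Longrightarrow> linear_map_on U W (\<lambda>x. g (f x))"
  by (auto simp: linear_map_on_def Pi_iff)

lemma linear_map_on_subset:
  "linear_map_on V W f \<Longrightarrow> U \<subseteq> V \<Longrightarrow> f ` U \<subseteq> X \<Longrightarrow> linear_map_on U X f"
  by (simp add: linear_map_on_def Pi_iff image_subset_iff subset_iff)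

lemma linear_map_on_inverse:
  assumes f: "linear_map_on V W f" "fun_vs.subspace V" and bij: "bij_betw f V W"
  shows "linear_map_on W V (inv_into V f)"
proof -
  have W: "W = f ` V" using bij by (simp add: bij_betw_def)
  have inj: "inj_on f V" using bij by (simp add: bij_betw_def)
  show ?thesis unfolding linear_map_on_def
  proof (intro conjI ballI allI)
    show "inv_into V f \<in> W \<rightarrow> V" by (auto simp: W inv_into_into)
  next
    fix y z assume "y \<in> W" "z \<in> W"
    then obtain a b where ab: "a \<in> V" "b \<in> V" "y = f a" "z = f b" by (auto simp: W)
    then have "f a + f b = f (a + b)" "a + b \<in> V"
      using linear_map_onD(2)[OF f(1)] fun_vs.subspace_add[OF f(2)] by auto
    then show "inv_into V f (y + z) = inv_into V f y + inv_into V f z"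
      using ab inj by simp
  next
    fix c y assume "y \<in> W"
    then obtain a where ab: "a \<in> V" "y = f a" by (auto simp: W)
    then have "fscale c (f a) = f (fscale c a)" "fscale c a \<in> V"
      using linear_map_onD(3)[OF f(1)] fun_vs.subspace_scale[OF f(2)] by auto
    then show "inv_into V f (fscale c y) = fscale c (inv_into V f y)"
      using ab inj by simp
  qed
qed

lemma linear_map_on_image_subspace:
  assumes f: "linear_map_on V W f" and V: "fun_vs.subspace V"
  shows "fun_vs.subspace (f ` V)"
proof (rule fun_vs.subspaceI)
  show "0 \<in> f ` V" using linear_map_on_zero[OF f V] fun_vs.subspace_0[OF V] by force
next
  fix x y assume "x \<in> f ` V" "y \<in> f ` V"
  then show "x + y \<in> f ` V"
    by (smt (verit) image_iff linear_map_onD(2)[OF f] fun_vs.subspace_add[OF V])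
next
  fix c x assume "x \<in> f ` V"
  then show "fscale c x \<in> f ` V"
    by (smt (verit) image_iff linear_map_onD(3)[OF f] fun_vs.subspace_scale[OF V])
qed

lemma linear_map_on_kernel_subspace:
  assumes f: "linear_map_on V W f" and V: "fun_vs.subspace V"
  shows "fun_vs.subspace {x \<in> V. f x = 0}"
  by (rule fun_vs.subspaceI)
    (auto simp: fun_vs.subspace_0[OF V] fun_vs.subspace_add[OF V] fun_vs.subspace_scale[OF V]
      linear_map_onD[OF f] linear_map_on_zero[OF f V])

lemma fin_dim_space_image:
  assumes V: "fin_dim_space V" and f: "linear_map_on V W f"
  shows "fin_dim_space (f ` V)"
proof -
  obtain B where B: "finite B" "fun_vs.span B = V"
    using V by (auto simp: fin_dim_space_def)
  note sV = fin_dim_space_subspace[OF V]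
  have BV: "B \<subseteq> V" using B fun_vs.span_superset by auto
  have "f x \<in> fun_vs.span (f ` B)" if "x \<in> V" for x
  proof -
    have "x \<in> range (\<lambda>u. \<Sum>b\<in>B. fscale (u b) b)"
      using that fun_vs.span_finite[OF B(1)] B(2) by simp
    then obtain u where x: "x = (\<Sum>b\<in>B. fscale (u b) b)" by (rule rangeE)
    have "f x = (\<Sum>b\<in>B. f (fscale (u b) b))"
      unfolding x using BV fun_vs.subspace_scale[OF sV] by (intro linear_map_on_sum[OF f sV]) auto
    also have "\<dots> = (\<Sum>b\<in>B. fscale (u b) (f b))"
      using linear_map_onD(3)[OF f] BV by (intro sum.cong) auto
    finally show ?thesis
      by (simp only:) (intro fun_vs.span_sum fun_vs.span_scale fun_vs.span_base imageI)
  qed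
  moreover have "fun_vs.span (f ` B) \<subseteq> f ` V"
    using BV linear_map_on_image_subspace[OF f sV] by (intro fun_vs.span_minimal) auto
  ultimately have "fun_vs.span (f ` B) = f ` V" by auto
  then show ?thesis using B by (auto simp: fin_dim_space_def)
qed

section \<open>Pivot coordinates and continuity\<close>

text \<open>\<open>J\<close> is a set of pivot columns and \<open>e\<close> the rows of a basis of \<open>V\<close> in reduced echelon form: the
  coordinates of a vector with respect to this basis are some of its own coordinates as a
  function. They are therefore continuous, which is what the topology of \<open>V\<close> is read off from.\<close>

definition pivots :: "('i \<Rightarrow> 'a::real_normed_field) set \<Rightarrow> 'i set \<Rightarrow> ('i \<Rightarrow> 'i \<Rightarrow> 'a) \<Rightarrow> bool" where
  "pivots V J e \<longleftrightarrow> finite J \<and> (\<forall>j\<in>J. e j \<in> V) \<and>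
     (\<forall>x\<in>V. x = (\<Sum>j\<in>J. fscale (x j) (e j))) \<and> (\<forall>j\<in>J. \<forall>k\<in>J. e j k = (if j = k then 1 else 0))"

lemma pivots_empty: "pivots (fun_vs.span {}) {} e"
  unfolding pivots_def by simp

text \<open>Gauss--Jordan elimination, one spanning vector at a time.\<close>

lemma pivots_exist:
  assumes "fin_dim_space V"
  obtains J e where "pivots V J e"
proof -
  obtain B where B: "finite B" "fun_vs.span B = V"
    using assms by (auto simp: fin_dim_space_def)
  have "\<exists>J e. pivots (fun_vs.span B) J e"
    using B(1)
  proof (induction B)
    case empty
    show ?case using pivots_empty by blast
  next
    case (insert v B)
    let ?S = "fun_vs.span B"
    let ?S' = "fun_vs.span (insert v B)"
    obtain J e where P: "pivots ?S J e" using insert by auto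
    have fin: "finite J" and eS: "j \<in> J \<Longrightarrow> e j \<in> ?S"
      and rep: "x \<in> ?S \<Longrightarrow> x = (\<Sum>j\<in>J. fscale (x j) (e j))"
      and dual: "j \<in> J \<Longrightarrow> k \<in> J \<Longrightarrow> e j k = (if j = k then 1 else 0)" for j k x
      using P unfolding pivots_def by blast+
    define p where "p x = (\<Sum>j\<in>J. fscale (x j) (e j))" for x
    have pS: "p x \<in> ?S" for x
      unfolding p_def by (intro fun_vs.span_sum fun_vs.span_scale eS)
    have p_coord: "p x k = x k" if "k \<in> J" for x k
    proof -
      have "p x k = (\<Sum>j\<in>J. if k = j then x j else 0)"
        unfolding p_def sum_fun_apply using that by (intro sum.cong) (auto simp: dual fscale_apply)
      then show ?thesis using that fin by (simp add: sum.delta)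
    qed
    define w where "w = v - p v"
    have wJ: "w k = 0" if "k \<in> J" for k using that by (simp add: w_def p_coord)
    have dec: "\<exists>c. x = p x + fscale c w" if x: "x \<in> ?S'" for x
    proof -
      obtain c where c: "x - fscale c v \<in> ?S"
        using x unfolding fun_vs.span_breakdown_eq ..
      have "fscale c v = fscale c (p v) + fscale c w"
        by (simp add: w_def fun_vs.scale_right_distrib[symmetric])
      then have y: "x - fscale c w \<in> ?S"
        using fun_vs.span_add[OF c fun_vs.span_scale[OF pS[of v], of c]] by (simp add: algebra_simps)
      have "x - fscale c w = p (x - fscale c w)" unfolding p_def using rep[OF y] .
      also have "\<dots> = p x"
        unfolding p_def by (intro sum.cong refl) (simp add: wJ fscale_apply)
      finally show ?thesis by (metis diff_eq_eq)
    qed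
    have mono: "?S \<subseteq> ?S'" by (intro fun_vs.span_mono) auto
    show ?case
    proof (cases "w = 0")
      case True
      have "x = p x" if "x \<in> ?S'" for x using dec[OF that] True by auto
      then have "pivots ?S' J e"
        using fin eS mono dual unfolding pivots_def p_def by blast
      then show ?thesis by blast
    next
      case False
      then obtain k where k: "w k \<noteq> 0" by (auto simp: fun_eq_iff)
      have kJ: "k \<notin> J" using k wJ by auto
      \<comment> \<open>one step of Gauss elimination: \<open>w\<close> vanishes at the old pivots, so it is rescaled to
        a new dual vector at \<open>k\<close> and subtracted from the old ones\<close>
      define u where "u = fscale (1 / w k) w"
      define e' where "e' j = (if j = k then u else e j - fscale (e j k) u)" for j
      have uS: "u \<in> ?S'" unfolding u_def w_def
        using mono pS fun_vs.span_base[of v "insert v B"]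
        by (intro fun_vs.span_scale fun_vs.span_diff) auto
      have uk: "u k = 1" and uJ: "j \<in> J \<Longrightarrow> u j = 0" for j
        using k wJ by (auto simp: u_def fscale_apply)
      have wu: "w = fscale (w k) u" using k by (auto simp: u_def fun_eq_iff fscale_apply)
      have "pivots ?S' (insert k J) e'"
        unfolding pivots_def
      proof (intro conjI ballI)
        show "finite (insert k J)" using fin by simp
        show "e' j \<in> ?S'" if "j \<in> insert k J" for j
          using that uS eS mono unfolding e'_def
          by (auto intro!: fun_vs.span_diff fun_vs.span_scale)
        show "e' j l = (if j = l then 1 else 0)" if "j \<in> insert k J" "l \<in> insert k J" for j l
          using that uk uJ kJ dual by (auto simp: e'_def fscale_apply)
        show "x = (\<Sum>j\<in>insert k J. fscale (x j) (e' j))" if x: "x \<in> ?S'" for x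
        proof -
          obtain c where c: "x = p x + fscale c w" using dec[OF x] by blast
          define d where "d = c * w k"
          have cu: "x = p x + fscale d u"
            using c wu unfolding d_def by (metis fun_vs.scale_scale)
          have xk: "x k = p x k + d" using fun_cong[OF cu, of k] uk by (simp add: fscale_apply)
          have "(\<Sum>j\<in>insert k J. fscale (x j) (e' j)) =
              fscale (x k) u + (\<Sum>j\<in>J. fscale (x j) (e j - fscale (e j k) u))"
            using kJ fin by (auto simp: e'_def intro!: sum.cong)
          also have "(\<Sum>j\<in>J. fscale (x j) (e j - fscale (e j k) u)) = p x - fscale (p x k) u"
          proof
            fix i
            show "(\<Sum>j\<in>J. fscale (x j) (e j - fscale (e j k) u)) i = (p x - fscale (p x k) u) i"
              by (simp add: p_def sum_fun_apply fscale_apply sum_distrib_left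
                  sum_subtractf algebra_simps)
          qed
          also have "fscale (x k) u + (p x - fscale (p x k) u) = p x + fscale d u"
            by (rule ext) (simp add: xk fscale_apply algebra_simps)
          finally show ?thesis by (rule trans[OF cu sym])
        qed
      qed
      then show ?thesis by blast
    qed
  qed
  then show ?thesis using B that by auto
qed

definition supported_on :: "'i set \<Rightarrow> ('i \<Rightarrow> 'a::zero) set" where
  "supported_on J = {x. \<forall>p. p \<notin> J \<longrightarrow> x p = 0}"

lemma supported_on_pivots:
  assumes "finite J"
  shows "pivots (supported_on J) J (\<lambda>j. (\<lambda>i. if i = j then 1 else 0))"
  unfolding pivots_def supported_on_def
  using assms by (auto simp: fun_eq_iff sum_fun_apply fscale_apply if_distrib cong: if_cong)

lemma subspace_supported_on: "fun_vs.subspace (supported_on J)"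
  by (rule fun_vs.subspaceI) (auto simp: supported_on_def fscale_apply)

lemma fin_dim_space_supported_on:
  assumes "finite J"
  shows "fin_dim_space (supported_on J :: ('i \<Rightarrow> 'a::real_normed_field) set)"
proof -
  define e :: "'i \<Rightarrow> 'i \<Rightarrow> 'a" where "e = (\<lambda>j i. if i = j then 1 else 0)"
  have P: "pivots (supported_on J) J e" using supported_on_pivots[OF assms] unfolding e_def .
  have "fun_vs.span (e ` J) = supported_on J"
  proof
    show "fun_vs.span (e ` J) \<subseteq> supported_on J"
      using P subspace_supported_on by (intro fun_vs.span_minimal) (auto simp: pivots_def)
    show "supported_on J \<subseteq> fun_vs.span (e ` J)"
    proof
      fix x :: "'i \<Rightarrow> 'a" assume "x \<in> supported_on J"
      then have "x = (\<Sum>j\<in>J. fscale (x j) (e j))" using P unfolding pivots_def by blast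
      moreover have "(\<Sum>j\<in>J. fscale (x j) (e j)) \<in> fun_vs.span (e ` J)"
        by (intro fun_vs.span_sum fun_vs.span_scale fun_vs.span_base imageI)
      ultimately show "x \<in> fun_vs.span (e ` J)" by metis
    qed
  qed
  then show ?thesis using assms unfolding fin_dim_space_def by blast
qed

lemma coord_space_eq_supported: "coord_space m = supported_on {..<m}"
  by (auto simp: coord_space_def supported_on_def not_less)

lemma continuous_on_coordinate: "continuous_on S (\<lambda>x :: 'i \<Rightarrow> 'a::topological_space. x i)"
  by (rule continuous_on_subset[OF continuous_on_product_coordinates]) simp

text \<open>A linear map on a finite-dimensional space is a finite sum of pivot coordinates times
  fixed vectors.\<close>

lemma linear_map_on_continuous:
  assumes V: "fin_dim_space V" and f: "linear_map_on V W f"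
  shows "continuous_on V f"
proof -
  obtain J e where P: "pivots V J e" using pivots_exist[OF V] .
  have "f x = (\<Sum>j\<in>J. fscale (x j) (f (e j)))" if "x \<in> V" for x
  proof -
    have e: "j \<in> J \<Longrightarrow> e j \<in> V" for j using P by (auto simp: pivots_def)
    have "f x = f (\<Sum>j\<in>J. fscale (x j) (e j))"
      using P that unfolding pivots_def by metis
    also have "\<dots> = (\<Sum>j\<in>J. fscale (x j) (f (e j)))"
      using e fin_dim_space_subspace[OF V]
      by (subst linear_map_on_sum[OF f]) (auto simp: fun_vs.subspace_scale linear_map_onD[OF f])
    finally show ?thesis .
  qed
  moreover have "continuous_on V (\<lambda>x. \<Sum>j\<in>J. fscale (x j) (f (e j)))"
    by (intro continuous_on_coordinatewise_then_product)
      (auto simp: sum_fun_apply fscale_apply intro!: continuous_intros continuous_on_coordinate)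
  ultimately show ?thesis by (simp cong: continuous_on_cong)
qed

text \<open>The inverse of a linear bijection is again a linear map on a finite-dimensional space, so it is
  continuous for the same reason as the map itself.\<close>

lemma linear_bijection_homeomorphism:
  assumes V: "fin_dim_space V" and f: "linear_map_on V W f" and bij: "bij_betw f V W"
  shows "homeomorphism V W f (inv_into V f)"
proof -
  have "fin_dim_space W" using fin_dim_space_image[OF V f] bij by (simp add: bij_betw_def)
  then have "continuous_on W (inv_into V f)"
    using linear_map_on_continuous linear_map_on_inverse[OF f fin_dim_space_subspace[OF V] bij] by blast
  moreover have "inv_into V f ` W = V"
    using bij_betw_inv_into[OF bij] by (simp add: bij_betw_def)
  ultimately show ?thesis
    using bij linear_map_on_continuous[OF V f]
    by (auto simp: homeomorphism_def bij_betw_def f_inv_into_f)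
qed

text \<open>Reading off the pivot coordinates gives the linear homeomorphism onto a standard space.\<close>

lemma homeomorphic_supported_on_pivots:
  assumes V: "fun_vs.subspace V" and P: "pivots V J e"
  shows "\<exists>g. homeomorphism V (supported_on J) (\<lambda>x i. if i \<in> J then x i else 0) g"
proof -
  let ?g = "\<lambda>y. \<Sum>j\<in>J. fscale (y j) (e j)"
  have fin: "finite J" and e: "j \<in> J \<Longrightarrow> e j \<in> V"
    and rep: "x \<in> V \<Longrightarrow> (\<Sum>j\<in>J. fscale (x j) (e j)) = x"
    and dual: "j \<in> J \<Longrightarrow> k \<in> J \<Longrightarrow> e j k = (if j = k then 1 else 0)" for j k x
    using P unfolding pivots_def by auto
  have "homeomorphism V (supported_on J) (\<lambda>x i. if i \<in> J then x i else 0) ?g"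
  proof (rule homeomorphismI)
    show "continuous_on V (\<lambda>x i. if i \<in> J then x i else 0)"
    proof (rule continuous_on_coordinatewise_then_product)
      show "continuous_on V (\<lambda>x. if i \<in> J then x i else 0)" for i
        by (cases "i \<in> J") (auto intro: continuous_on_coordinate)
    qed
    show "continuous_on (supported_on J) ?g"
      by (intro continuous_on_coordinatewise_then_product)
        (auto simp: sum_fun_apply fscale_apply intro!: continuous_intros continuous_on_coordinate)
    show "?g ` supported_on J \<subseteq> V"
      using e V by (auto intro!: fun_vs.subspace_sum fun_vs.subspace_scale)
    show "(\<lambda>i. if i \<in> J then ?g y i else 0) = y" if "y \<in> supported_on J" for y
    proof
      fix i
      have "?g y i = (\<Sum>j\<in>J. if i = j then y j else 0)" if "i \<in> J"
        unfolding sum_fun_apply using that by (intro sum.cong) (auto simp: dual fscale_apply)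
      then show "(if i \<in> J then ?g y i else 0) = y i"
        using that fin by (auto simp: supported_on_def)
    qed
  qed (auto simp: supported_on_def rep)
  then show ?thesis by blast
qed

section \<open>Invariance of dimension\<close>

lemma homeomorphic_imp_homeomorphic_space:
  "S homeomorphic T \<Longrightarrow> top_of_set S homeomorphic_space top_of_set T"
  unfolding homeomorphic_def homeomorphism_def homeomorphic_space_def homeomorphic_maps_def
  by (elim exE, rule exI, rule exI) (auto simp: continuous_map_in_subtopology)

text \<open>Each scalar splits into its real coordinates.\<close>

lemma supported_on_homeomorphic_real:
  assumes J: "finite J"
  shows "(supported_on J :: ('i \<Rightarrow> 'a::euclidean_space) set) homeomorphic
    (supported_on {..<card J * DIM('a)} :: (nat \<Rightarrow> real) set)"
proof -
  let ?B = "Basis :: 'a set"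
  let ?n = "card J * DIM('a)"
  obtain h where h: "bij_betw h {..<?n} (J \<times> ?B)"
    using J finite_same_card_bij[of "{..<?n}" "J \<times> ?B"] by (auto simp: card_cartesian_product)
  let ?h' = "inv_into {..<?n} h"
  have hm: "fst (h k) \<in> J" "snd (h k) \<in> ?B" if "k < ?n" for k
    using bij_betwE[OF h] that by (auto simp: mem_Times_iff)
  have h'm: "?h' (j, b) < ?n" "h (?h' (j, b)) = (j, b)" if "j \<in> J" "b \<in> ?B" for j b
    using bij_betwE[OF bij_betw_inv_into[OF h]] bij_betw_inv_into_right[OF h] that by auto
  have h'h: "?h' (h k) = k" if "k < ?n" for k
    using bij_betw_inv_into_left[OF h] that by auto
  define F where "F x k = (if k < ?n then x (fst (h k)) \<bullet> snd (h k) else 0)"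
    for x :: "'i \<Rightarrow> 'a" and k
  define G where "G y j = (if j \<in> J then \<Sum>b\<in>?B. y (?h' (j, b)) *\<^sub>R b else 0)"
    for y :: "nat \<Rightarrow> real" and j
  have "homeomorphism (supported_on J) (supported_on {..<?n}) F G"
  proof (rule homeomorphismI)
    show "continuous_on (supported_on J) F"
    proof (rule continuous_on_coordinatewise_then_product)
      show "continuous_on (supported_on J) (\<lambda>x. F x i)" for i
        unfolding F_def by (cases "i < ?n") (auto intro!: continuous_intros continuous_on_coordinate)
    qed
    show "continuous_on (supported_on {..<?n}) G"
    proof (rule continuous_on_coordinatewise_then_product)
      show "continuous_on (supported_on {..<?n}) (\<lambda>x. G x i)" for i
        unfolding G_def by (cases "i \<in> J") (auto intro!: continuous_intros continuous_on_coordinate)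
    qed
    show "G (F x) = x" if "x \<in> supported_on J" for x
    proof
      fix j
      have "(\<Sum>b\<in>?B. F x (?h' (j, b)) *\<^sub>R b) = (\<Sum>b\<in>?B. (x j \<bullet> b) *\<^sub>R b)" if "j \<in> J"
        using h'm that by (intro sum.cong) (auto simp: F_def)
      then show "G (F x) j = x j"
        using that by (auto simp: G_def supported_on_def euclidean_representation)
    qed
    show "F (G y) = y" if "y \<in> supported_on {..<?n}" for y
    proof
      fix k
      have "G y (fst (h k)) \<bullet> snd (h k) = y k" if k: "k < ?n"
      proof -
        have "G y (fst (h k)) \<bullet> snd (h k) =
            (\<Sum>b\<in>?B. y (?h' (fst (h k), b)) * (if b = snd (h k) then 1 else 0))"
          using hm[OF k] by (simp add: G_def inner_sum_left inner_Basis)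
        also have "\<dots> = y (?h' (fst (h k), snd (h k)))"
          using hm[OF k] by (simp add: if_distrib cong: if_cong)
        finally show ?thesis using h'h[OF k] by simp
      qed
      then show "F (G y) k = y k"
        using that by (auto simp: F_def supported_on_def)
    qed
  qed (auto simp: supported_on_def F_def G_def)
  then show ?thesis by (auto simp: homeomorphic_def)
qed

text \<open>Topological invariance of the number of coordinates: over the reals this is Brouwer's
  invariance of dimension, and a Euclidean field contributes a fixed number of real coordinates
  each.\<close>

lemma supported_on_homeomorphic_imp_card_eq:
  assumes J: "finite J" "finite K"
    and hom: "(supported_on J :: ('i \<Rightarrow> 'a::euclidean_space) set) homeomorphic
      (supported_on K :: ('j \<Rightarrow> 'a) set)"
  shows "card J = card K"
proof -
  let ?m = "card J * DIM('a)" and ?n = "card K * DIM('a)"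
  have "(supported_on {..<?m} :: (nat \<Rightarrow> real) set) homeomorphic (supported_on {..<?n} :: (nat \<Rightarrow> real) set)"
    using supported_on_homeomorphic_real[OF J(1), where 'a='a]
      supported_on_homeomorphic_real[OF J(2), where 'a='a] hom
      homeomorphic_trans homeomorphic_sym by metis
  moreover have "top_of_set (supported_on {..<m} :: (nat \<Rightarrow> real) set) = Euclidean_space m" for m
    by (auto simp: Euclidean_space_def euclidean_product_topology supported_on_def not_less
        intro: arg_cong[where f=top_of_set])
  ultimately have "Euclidean_space ?m homeomorphic_space Euclidean_space ?n"
    using homeomorphic_imp_homeomorphic_space by metis
  then have "?m = ?n" by (simp only: invariance_of_dimension_Euclidean_space)
  then show ?thesis by simp
qed

section \<open>Walks around a cycle\<close>

abbreviation vtx :: "nat \<Rightarrow> nat \<Rightarrow> nat \<Rightarrow> nat" where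
  "vtx t i k \<equiv> (next_vertex t ^^ k) i"

lemma next_vertex_in: "i \<in> {1..t} \<Longrightarrow> next_vertex t i \<in> {1..t}"
  by (auto simp: next_vertex_def)

lemma vtx_in: "i \<in> {1..t} \<Longrightarrow> vtx t i k \<in> {1..t}"
proof (induction k)
  case (Suc k)
  then show ?case using next_vertex_in by (simp only: funpow.simps comp_apply)
qed simp

lemma vtx_vtx: "vtx t (vtx t i k) l = vtx t i (k + l)"
  by (metis add.commute comp_apply funpow_add)

lemma vtx_Suc': "vtx t (next_vertex t i) k = vtx t i (Suc k)"
  by (simp add: funpow_swap1)

lemma vtx_mod:
  assumes "i \<in> {1..t}"
  shows "vtx t i k = (i - 1 + k) mod t + 1"
proof -
  obtain j where j: "i = Suc j" "j < t" using assms by (cases i) auto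
  have "vtx t (Suc j) k = (j + k) mod t + 1"
    by (induction k) (use j in \<open>auto simp: next_vertex_def mod_Suc\<close>)
  then show ?thesis using j by simp
qed

lemma vtx_mult: "i \<in> {1..t} \<Longrightarrow> vtx t i (N * t) = i"
  using vtx_mod[of i t "N * t"] by (cases i) auto

lemma vtx_period: "i \<in> {1..t} \<Longrightarrow> vtx t i t = i"
  using vtx_mult[of i t 1] by simp

lemma vtx_from_1: "k < t \<Longrightarrow> vtx t 1 k = Suc k"
  using vtx_mod[of 1 t k] by simp

lemma next_vertex_surj:
  assumes "i \<in> {1..t}"
  obtains j where "j \<in> {1..t}" "next_vertex t j = i"
proof -
  have "next_vertex t (vtx t i (t - 1)) = vtx t i (Suc (t - 1))" by simp
  also have "Suc (t - 1) = t" using assms by simp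
  finally have "next_vertex t (vtx t i (t - 1)) = i" using vtx_period[OF assms] by simp
  then show ?thesis using that vtx_in[OF assms] by blast
qed

lemma next_vertex_inj:
  assumes "i \<in> {1..t}" "j \<in> {1..t}" "next_vertex t i = next_vertex t j"
  shows "i = j"
  using assms by (cases "i = t"; cases "j = t") (simp_all add: next_vertex_def)

lemma vtx_inj:
  assumes "i \<in> {1..t}" "j \<in> {1..t}" "vtx t i k = vtx t j k"
  shows "i = j"
  using assms(3)
proof (induction k)
  case (Suc k)
  then show ?case
    using next_vertex_inj[OF vtx_in[OF assms(1), of k] vtx_in[OF assms(2), of k]] by simp
qed simp

text \<open>The composite of \<open>k\<close> consecutive mappings, starting at vertex \<open>i\<close> and running around the cycle
  as often as \<open>k\<close> requires. Kernels of walks split off the regular part, images of walks are what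
  a homeomorphism can see.\<close>

primrec walk :: "nat \<Rightarrow> ('i, 'a) lcycle \<Rightarrow> nat \<Rightarrow> nat \<Rightarrow> ('i \<Rightarrow> 'a) \<Rightarrow> 'i \<Rightarrow> 'a" where
  "walk t A i 0 x = x"
| "walk t A i (Suc k) x = mp A (vtx t i k) (walk t A i k x)"

lemma walk_add: "walk t A i (k + l) x = walk t A (vtx t i k) l (walk t A i k x)"
  by (induction l) (simp_all add: vtx_vtx)

lemma walk_Suc': "walk t A i (Suc k) x = walk t A (next_vertex t i) k (mp A i x)"
  using walk_add[of t A i 1 k x] by simp

lemma lin_cycleD:
  assumes "lin_cycle t A" "i \<in> {1..t}"
  shows "fin_dim_space (spc A i)" "fun_vs.subspace (spc A i)"
    "linear_map_on (spc A i) (spc A (next_vertex t i)) (mp A i)"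
    "x \<in> spc A i \<Longrightarrow> mp A i x \<in> spc A (next_vertex t i)"
proof -
  show 1: "fin_dim_space (spc A i)" "linear_map_on (spc A i) (spc A (next_vertex t i)) (mp A i)"
    using assms by (simp_all add: lin_cycle_def)
  show "fun_vs.subspace (spc A i)" using fin_dim_space_subspace[OF 1(1)] .
  show "x \<in> spc A i \<Longrightarrow> mp A i x \<in> spc A (next_vertex t i)" using linear_map_onD(1)[OF 1(2)] .
qed

text \<open>The set-theoretic content of being a cycle. It is what transports walks along a nonlinear
  transformation, and it passes to direct sums at once.\<close>

definition closed_cycle :: "nat \<Rightarrow> ('i, 'a) lcycle \<Rightarrow> bool" where
  "closed_cycle t A \<longleftrightarrow> (\<forall>i\<in>{1..t}. \<forall>x\<in>spc A i. mp A i x \<in> spc A (next_vertex t i))"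

lemma closed_cycleD:
  "closed_cycle t A \<Longrightarrow> i \<in> {1..t} \<Longrightarrow> x \<in> spc A i \<Longrightarrow> mp A i x \<in> spc A (next_vertex t i)"
  unfolding closed_cycle_def by blast

lemma lin_cycle_closed: "lin_cycle t A \<Longrightarrow> closed_cycle t A"
  unfolding closed_cycle_def using lin_cycleD(4) by blast

lemma walk_closed:
  assumes "closed_cycle t A" "i \<in> {1..t}" "x \<in> spc A i"
  shows "walk t A i k x \<in> spc A (vtx t i k)"
proof (induction k)
  case (Suc k)
  then show ?case using closed_cycleD[OF assms(1) vtx_in[OF assms(2)]] by simp
qed (use assms in simp)

lemma walk_linear:
  assumes "lin_cycle t A" "i \<in> {1..t}"
  shows "linear_map_on (spc A i) (spc A (vtx t i k)) (walk t A i k)"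
proof (induction k)
  case 0
  show ?case by (simp add: linear_map_on_def)
next
  case (Suc k)
  show ?case
    using linear_map_on_comp[OF Suc lin_cycleD(3)[OF assms(1) vtx_in[OF assms(2)], of k]]
    by (simp add: fun_eq_iff[symmetric])
qed

lemma walk_in:
  "lin_cycle t A \<Longrightarrow> i \<in> {1..t} \<Longrightarrow> x \<in> spc A i \<Longrightarrow> walk t A i k x \<in> spc A (vtx t i k)"
  using walk_linear linear_map_onD(1) by blast

lemma walk_zero: "lin_cycle t A \<Longrightarrow> i \<in> {1..t} \<Longrightarrow> walk t A i k 0 = 0"
  using linear_map_on_zero[OF walk_linear lin_cycleD(2)] .

section \<open>Isomorphism and topological equivalence\<close>

lemma transforms_sym:
  assumes "transforms t \<phi> A B" and A: "closed_cycle t A"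
  shows "transforms t (\<lambda>i. inv_into (spc A i) (\<phi> i)) B A"
  unfolding transforms_def
proof (intro ballI conjI)
  fix i assume i: "i \<in> {1..t}"
  have bij: "bij_betw (\<phi> i) (spc A i) (spc B i)" if "i \<in> {1..t}" for i
    using assms(1) that by (simp add: transforms_def)
  show "bij_betw (inv_into (spc A i) (\<phi> i)) (spc B i) (spc A i)"
    using bij_betw_inv_into[OF bij[OF i]] .
  fix y assume "y \<in> spc B i"
  then obtain x where x: "x \<in> spc A i" "y = \<phi> i x"
    using bij[OF i] by (auto simp: bij_betw_def)
  then have "mp B i y = \<phi> (next_vertex t i) (mp A i x)"
    using assms(1) i by (simp add: transforms_def)
  then show "inv_into (spc A (next_vertex t i)) (\<phi> (next_vertex t i)) (mp B i y) =
      mp A i (inv_into (spc A i) (\<phi> i) y)"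
    using x closed_cycleD[OF A i] bij_betw_inv_into_left[OF bij[OF i]]
      bij_betw_inv_into_left[OF bij[OF next_vertex_in[OF i]]] by simp
qed

lemma transforms_trans:
  assumes "transforms t \<phi> A B" "transforms t \<psi> B C"
  shows "transforms t (\<lambda>i. \<psi> i \<circ> \<phi> i) A C"
  using assms unfolding transforms_def
  by (auto intro: bij_betw_trans) (metis atLeastAtMost_iff bij_betw_apply)

lemma transforms_walk:
  assumes \<phi>: "transforms t \<phi> A B" and A: "closed_cycle t A" and i: "i \<in> {1..t}" and x: "x \<in> spc A i"
  shows "\<phi> (vtx t i k) (walk t A i k x) = walk t B i k (\<phi> i x)"
proof (induction k)
  case (Suc k)
  then show ?case
    using \<phi> vtx_in[OF i, of k] walk_closed[OF A i x, of k] by (simp add: transforms_def)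
qed simp

lemma transforms_bij: "transforms t \<phi> A B \<Longrightarrow> i \<in> {1..t} \<Longrightarrow> bij_betw (\<phi> i) (spc A i) (spc B i)"
  by (simp add: transforms_def)

lemma isomorphic_cycles_sym:
  assumes "isomorphic_cycles t A B"
    and sub: "\<And>i. i \<in> {1..t} \<Longrightarrow> fun_vs.subspace (spc A i)"
    and A: "closed_cycle t A"
  shows "isomorphic_cycles t B A"
proof -
  obtain \<phi> where \<phi>: "transforms t \<phi> A B"
      "\<forall>i\<in>{1..t}. linear_map_on (spc A i) (spc B i) (\<phi> i)"
    using assms by (auto simp: isomorphic_cycles_def)
  have "transforms t (\<lambda>i. inv_into (spc A i) (\<phi> i)) B A"
    by (rule transforms_sym[OF \<phi>(1) A])
  moreover have "linear_map_on (spc B i) (spc A i) (inv_into (spc A i) (\<phi> i))" if "i \<in> {1..t}" for i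
    using \<phi>(2) that linear_map_on_inverse[OF _ sub[OF that] transforms_bij[OF \<phi>(1) that]]
    by blast
  ultimately show ?thesis unfolding isomorphic_cycles_def by blast
qed

lemma isomorphic_cycles_trans:
  assumes "isomorphic_cycles t A B" "isomorphic_cycles t B C"
  shows "isomorphic_cycles t A C"
proof -
  obtain \<phi> \<psi> where \<phi>: "transforms t \<phi> A B"
      "\<forall>i\<in>{1..t}. linear_map_on (spc A i) (spc B i) (\<phi> i)"
    and \<psi>: "transforms t \<psi> B C"
      "\<forall>i\<in>{1..t}. linear_map_on (spc B i) (spc C i) (\<psi> i)"
    using assms by (auto simp: isomorphic_cycles_def)
  have "linear_map_on (spc A i) (spc C i) (\<psi> i \<circ> \<phi> i)" if "i \<in> {1..t}" for i
    unfolding comp_def using \<phi>(2) \<psi>(2) that linear_map_on_comp by blast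
  then show ?thesis unfolding isomorphic_cycles_def
    using transforms_trans[OF \<phi>(1) \<psi>(1)] by blast
qed

lemma isomorphic_cycles_refl: "isomorphic_cycles t A A"
  unfolding isomorphic_cycles_def transforms_def
  by (rule exI[of _ "\<lambda>_ x. x"]) (auto simp: linear_map_on_def bij_betw_def)

lemma isomorphic_imp_top_equiv:
  assumes "isomorphic_cycles t A B" "lin_cycle t A"
  shows "top_equiv_cycles t A B"
proof -
  obtain \<phi> where \<phi>: "transforms t \<phi> A B"
      "\<forall>i\<in>{1..t}. linear_map_on (spc A i) (spc B i) (\<phi> i)"
    using assms by (auto simp: isomorphic_cycles_def)
  have "\<exists>\<psi>. homeomorphism (spc A i) (spc B i) (\<phi> i) \<psi>" if "i \<in> {1..t}" for i
    using \<phi>(2) that transforms_bij[OF \<phi>(1) that]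
      linear_bijection_homeomorphism[OF lin_cycleD(1)[OF assms(2) that]] by blast
  then show ?thesis using \<phi>(1) unfolding top_equiv_cycles_def by blast
qed

lemma homeomorphism_inv_into:
  assumes "homeomorphism S T f g"
  shows "homeomorphism T S (inv_into S f) f"
proof -
  have "inv_into S f y = g y" if "y \<in> T" for y
  proof (rule inv_into_f_eq)
    show "inj_on f S" using assms by (metis homeomorphism_def inj_onI)
    show "g y \<in> S" "f (g y) = y" using assms that by (auto simp: homeomorphism_def)
  qed
  then show ?thesis
    using homeomorphism_cong[OF homeomorphism_symD[OF assms]] by metis
qed

lemma top_equiv_cycles_sym:
  assumes "top_equiv_cycles t A B"
    and A: "closed_cycle t A"
  shows "top_equiv_cycles t B A"
proof -
  obtain \<phi> where \<phi>: "transforms t \<phi> A B"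
      "\<forall>i\<in>{1..t}. \<exists>\<psi>. homeomorphism (spc A i) (spc B i) (\<phi> i) \<psi>"
    using assms by (auto simp: top_equiv_cycles_def)
  have "transforms t (\<lambda>i. inv_into (spc A i) (\<phi> i)) B A"
    by (rule transforms_sym[OF \<phi>(1) A])
  moreover have "\<exists>\<psi>. homeomorphism (spc B i) (spc A i) (inv_into (spc A i) (\<phi> i)) \<psi>"
    if "i \<in> {1..t}" for i
    using \<phi>(2) that homeomorphism_inv_into by blast
  ultimately show ?thesis unfolding top_equiv_cycles_def by blast
qed

lemma top_equiv_cycles_trans:
  assumes "top_equiv_cycles t A B" "top_equiv_cycles t B C"
  shows "top_equiv_cycles t A C"
proof -
  obtain \<phi> \<psi> where \<phi>: "transforms t \<phi> A B"
      "\<forall>i\<in>{1..t}. \<exists>g. homeomorphism (spc A i) (spc B i) (\<phi> i) g"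
    and \<psi>: "transforms t \<psi> B C"
      "\<forall>i\<in>{1..t}. \<exists>g. homeomorphism (spc B i) (spc C i) (\<psi> i) g"
    using assms by (auto simp: top_equiv_cycles_def)
  have "\<exists>g. homeomorphism (spc A i) (spc C i) (\<psi> i \<circ> \<phi> i) g" if "i \<in> {1..t}" for i
    using \<phi>(2) \<psi>(2) that homeomorphism_compose by blast
  then show ?thesis unfolding top_equiv_cycles_def
    using transforms_trans[OF \<phi>(1) \<psi>(1)] by blast
qed

section \<open>Direct sums\<close>

text \<open>Coordinate projections and injections of the two kinds of external direct sums. Named, they
  turn the direct sums into products and families, to be handled without reference to indices.\<close>

definition lpart :: "('i + 'j \<Rightarrow> 'a) \<Rightarrow> 'i \<Rightarrow> 'a" where "lpart x = (\<lambda>j. x (Inl j))"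
definition rpart :: "('i + 'j \<Rightarrow> 'a) \<Rightarrow> 'j \<Rightarrow> 'a" where "rpart x = (\<lambda>j. x (Inr j))"
definition join :: "('i \<Rightarrow> 'a) \<Rightarrow> ('j \<Rightarrow> 'a) \<Rightarrow> 'i + 'j \<Rightarrow> 'a" where "join u v = case_sum u v"

lemma join_simps [simp]:
  "lpart (join u v) = u" "rpart (join u v) = v" "join (lpart x) (rpart x) = x"
  by (auto simp: lpart_def rpart_def join_def fun_eq_iff split: sum.splits)

lemma parts_add: "lpart (x + y) = lpart x + lpart y" "rpart (x + y) = rpart x + rpart y"
  by (auto simp: lpart_def rpart_def fun_eq_iff)

lemma parts_fscale: "lpart (fscale c x) = fscale c (lpart x)" "rpart (fscale c x) = fscale c (rpart x)"
  by (auto simp: lpart_def rpart_def fun_eq_iff fscale_def)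

lemma sum_type_fun_eqI: "lpart x = lpart y \<Longrightarrow> rpart x = rpart y \<Longrightarrow> x = y"
  by (metis join_simps(3))

lemma join_add: "join (u + u') (v + v') = join u v + join u' v'"
  by (rule sum_type_fun_eqI) (simp_all only: parts_add join_simps)

lemma join_fscale: "join (fscale c u) (fscale c v) = fscale c (join u v)"
  by (rule sum_type_fun_eqI) (simp_all only: parts_fscale join_simps)

lemma dsum_simps:
  "spc (dsum A B) i = {x. lpart x \<in> spc A i \<and> rpart x \<in> spc B i}"
  "mp (dsum A B) i x = join (mp A i (lpart x)) (mp B i (rpart x))"
  by (simp_all add: dsum_def lpart_def rpart_def join_def)

definition slice :: "nat \<Rightarrow> (nat \<times> 'i \<Rightarrow> 'a) \<Rightarrow> 'i \<Rightarrow> 'a" where "slice k x = (\<lambda>j. x (k, j))"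
definition assemble :: "nat \<Rightarrow> (nat \<Rightarrow> 'i \<Rightarrow> 'a::zero) \<Rightarrow> nat \<times> 'i \<Rightarrow> 'a" where
  "assemble r u = (\<lambda>(k, j). if k \<in> {1..r} then u k j else 0)"

lemma slice_assemble [simp]: "k \<in> {1..r} \<Longrightarrow> slice k (assemble r u) = u k"
  by (auto simp: slice_def assemble_def)

lemma slice_assemble_out: "k \<notin> {1..r} \<Longrightarrow> slice k (assemble r u) = 0"
  by (rule ext) (auto simp: slice_def assemble_def)

lemma slice_add: "slice k (x + y) = slice k x + slice k y"
  by (auto simp: slice_def fun_eq_iff)

lemma slice_fscale: "slice k (fscale c x) = fscale c (slice k x)"
  by (auto simp: slice_def fun_eq_iff fscale_def)

lemma slice_eqI: "(\<And>k. slice k x = slice k y) \<Longrightarrow> x = y"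
  by (auto simp: slice_def fun_eq_iff)

lemma dsum_family_simps:
  "spc (dsum_family r S) i =
     {x. (\<forall>k\<in>{1..r}. slice k x \<in> spc (S k) i) \<and> (\<forall>k. k \<notin> {1..r} \<longrightarrow> slice k x = 0)}"
  "mp (dsum_family r S) i x = assemble r (\<lambda>k. mp (S k) i (slice k x))"
  by (auto simp: dsum_family_def slice_def assemble_def fun_eq_iff)

lemma dsum_family_eqI:
  assumes "x \<in> spc (dsum_family r S) i" "y \<in> spc (dsum_family r S') i"
    "\<And>k. k \<in> {1..r} \<Longrightarrow> slice k x = slice k y"
  shows "x = y"
  using assms by (intro slice_eqI) (metis (mono_tags, lifting) dsum_family_simps(1) mem_Collect_eq)

lemma dsum_closed:
  assumes "closed_cycle t A" "closed_cycle t B"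
  shows "closed_cycle t (dsum A B)"
  using assms unfolding closed_cycle_def by (simp add: dsum_simps)

lemma dsum_family_closed:
  assumes "\<And>k. k \<in> {1..r} \<Longrightarrow> closed_cycle t (S k)"
  shows "closed_cycle t (dsum_family r S)"
  using assms unfolding closed_cycle_def by (auto simp: dsum_family_simps slice_assemble_out)

lemma isomorphic_dsum:
  assumes "isomorphic_cycles t A A'" "isomorphic_cycles t B B'"
  shows "isomorphic_cycles t (dsum A B) (dsum A' B')"
proof -
  obtain \<phi> \<psi> where \<phi>: "transforms t \<phi> A A'"
      "\<forall>i\<in>{1..t}. linear_map_on (spc A i) (spc A' i) (\<phi> i)"
    and \<psi>: "transforms t \<psi> B B'"
      "\<forall>i\<in>{1..t}. linear_map_on (spc B i) (spc B' i) (\<psi> i)"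
    using assms by (auto simp: isomorphic_cycles_def)
  define \<theta> where "\<theta> i x = join (\<phi> i (lpart x)) (\<psi> i (rpart x))" for i x
  have "linear_map_on (spc (dsum A B) i) (spc (dsum A' B') i) (\<theta> i)" if i: "i \<in> {1..t}" for i
    unfolding linear_map_on_def \<theta>_def
    using linear_map_onD[OF \<phi>(2)[rule_format, OF i]] linear_map_onD[OF \<psi>(2)[rule_format, OF i]]
    by (simp add: dsum_simps parts_add parts_fscale join_add join_fscale Pi_iff)
  moreover have "transforms t \<theta> (dsum A B) (dsum A' B')"
    unfolding transforms_def
  proof (intro ballI conjI)
    fix i assume i: "i \<in> {1..t}"
    note bij = transforms_bij[OF \<phi>(1) i] transforms_bij[OF \<psi>(1) i]
    show "bij_betw (\<theta> i) (spc (dsum A B) i) (spc (dsum A' B') i)"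
      by (rule bij_betw_byWitness[where
          f' = "\<lambda>y. join (inv_into (spc A i) (\<phi> i) (lpart y)) (inv_into (spc B i) (\<psi> i) (rpart y))"])
        (auto simp: \<theta>_def dsum_simps bij_betw_inv_into_left[OF bij(1)] bij_betw_inv_into_left[OF bij(2)]
          bij_betw_inv_into_right[OF bij(1)] bij_betw_inv_into_right[OF bij(2)]
          bij_betw_apply[OF bij(1)] bij_betw_apply[OF bij(2)]
          bij_betw_apply[OF bij_betw_inv_into[OF bij(1)]] bij_betw_apply[OF bij_betw_inv_into[OF bij(2)]])
    show "\<theta> (next_vertex t i) (mp (dsum A B) i x) = mp (dsum A' B') i (\<theta> i x)"
      if "x \<in> spc (dsum A B) i" for x
      using that i \<phi>(1) \<psi>(1) by (simp add: \<theta>_def dsum_simps transforms_def)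
  qed
  ultimately show ?thesis unfolding isomorphic_cycles_def by blast
qed

lemma isomorphic_dsum_family:
  assumes "\<And>k. k \<in> {1..r} \<Longrightarrow> isomorphic_cycles t (S k) (S' k)"
  shows "isomorphic_cycles t (dsum_family r S) (dsum_family r S')"
proof -
  have "\<forall>k\<in>{1..r}. \<exists>\<phi>. transforms t \<phi> (S k) (S' k) \<and>
      (\<forall>i\<in>{1..t}. linear_map_on (spc (S k) i) (spc (S' k) i) (\<phi> i))"
    using assms by (simp add: isomorphic_cycles_def)
  then obtain \<phi> where \<phi>: "\<And>k. k \<in> {1..r} \<Longrightarrow> transforms t (\<phi> k) (S k) (S' k)"
      "\<And>k i. k \<in> {1..r} \<Longrightarrow> i \<in> {1..t} \<Longrightarrow> linear_map_on (spc (S k) i) (spc (S' k) i) (\<phi> k i)"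
    by (metis (no_types))
  define \<theta> where "\<theta> i x = assemble r (\<lambda>k. \<phi> k i (slice k x))" for i x
  define \<theta>' where "\<theta>' i x = assemble r (\<lambda>k. inv_into (spc (S k) i) (\<phi> k i) (slice k x))" for i x
  have slice_\<theta>: "slice k (\<theta> i x) = (if k \<in> {1..r} then \<phi> k i (slice k x) else 0)" for i x k
    using slice_assemble slice_assemble_out unfolding \<theta>_def by auto
  have slice_\<theta>': "slice k (\<theta>' i x) = (if k \<in> {1..r} then inv_into (spc (S k) i) (\<phi> k i) (slice k x) else 0)" for i x k
    using slice_assemble slice_assemble_out unfolding \<theta>'_def by auto
  have maps: "\<theta> i x \<in> spc (dsum_family r S') i" if "i \<in> {1..t}" "x \<in> spc (dsum_family r S) i" for i x
    using that linear_map_onD(1)[OF \<phi>(2)] by (simp add: dsum_family_simps slice_\<theta>)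
  have "linear_map_on (spc (dsum_family r S) i) (spc (dsum_family r S') i) (\<theta> i)" if i: "i \<in> {1..t}" for i
    unfolding linear_map_on_def
  proof (intro conjI ballI allI)
    show "\<theta> i \<in> spc (dsum_family r S) i \<rightarrow> spc (dsum_family r S') i" using maps[OF i] by blast
    show "\<theta> i (x + y) = \<theta> i x + \<theta> i y"
      if "x \<in> spc (dsum_family r S) i" "y \<in> spc (dsum_family r S) i" for x y
    proof (rule slice_eqI)
      show "slice k (\<theta> i (x + y)) = slice k (\<theta> i x + \<theta> i y)" for k
        using that linear_map_onD(2)[OF \<phi>(2)[OF _ i]]
        by (cases "k \<in> {1..r}") (auto simp: slice_\<theta> slice_add dsum_family_simps)
    qed
    show "\<theta> i (fscale c x) = fscale c (\<theta> i x)" if "x \<in> spc (dsum_family r S) i" for c x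
    proof (rule slice_eqI)
      show "slice k (\<theta> i (fscale c x)) = slice k (fscale c (\<theta> i x))" for k
        using that linear_map_onD(3)[OF \<phi>(2)[OF _ i]]
        by (cases "k \<in> {1..r}") (auto simp: slice_\<theta> slice_fscale dsum_family_simps)
    qed
  qed
  moreover have "transforms t \<theta> (dsum_family r S) (dsum_family r S')"
    unfolding transforms_def
  proof (intro ballI conjI)
    fix i assume i: "i \<in> {1..t}"
    have bij: "bij_betw (\<phi> k i) (spc (S k) i) (spc (S' k) i)" if "k \<in> {1..r}" for k
      using transforms_bij[OF \<phi>(1)[OF that] i] .
    have maps': "\<theta>' i x \<in> spc (dsum_family r S) i" if "x \<in> spc (dsum_family r S') i" for x
      using that bij_betw_apply[OF bij_betw_inv_into[OF bij]] by (simp add: dsum_family_simps slice_\<theta>')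
    show "bij_betw (\<theta> i) (spc (dsum_family r S) i) (spc (dsum_family r S') i)"
    proof (rule bij_betw_byWitness[where f' = "\<theta>' i"])
      show "\<forall>x\<in>spc (dsum_family r S) i. \<theta>' i (\<theta> i x) = x"
      proof
        fix x assume x: "x \<in> spc (dsum_family r S) i"
        show "\<theta>' i (\<theta> i x) = x"
        proof (rule dsum_family_eqI[OF maps'[OF maps[OF i x]] x])
          show "slice k (\<theta>' i (\<theta> i x)) = slice k x" if k: "k \<in> {1..r}" for k
            using x k bij_betw_inv_into_left[OF bij[OF k]]
            by (simp add: slice_\<theta> slice_\<theta>' dsum_family_simps)
        qed
      qed
      show "\<forall>x\<in>spc (dsum_family r S') i. \<theta> i (\<theta>' i x) = x"
      proof
        fix x assume x: "x \<in> spc (dsum_family r S') i"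
        show "\<theta> i (\<theta>' i x) = x"
        proof (rule dsum_family_eqI[OF maps[OF i maps'[OF x]] x])
          show "slice k (\<theta> i (\<theta>' i x)) = slice k x" if k: "k \<in> {1..r}" for k
            using x k bij_betw_inv_into_right[OF bij[OF k]]
            by (simp add: slice_\<theta> slice_\<theta>' dsum_family_simps)
        qed
      qed
    qed (use maps[OF i] maps' in auto)
    show "\<theta> (next_vertex t i) (mp (dsum_family r S) i x) = mp (dsum_family r S') i (\<theta> i x)"
      if x: "x \<in> spc (dsum_family r S) i" for x
    proof (rule slice_eqI)
      fix k
      show "slice k (\<theta> (next_vertex t i) (mp (dsum_family r S) i x)) = slice k (mp (dsum_family r S') i (\<theta> i x))"
      proof (cases "k \<in> {1..r}")
        case True
        then show ?thesis
          using x i \<phi>(1)[OF True] by (simp add: slice_\<theta> dsum_family_simps transforms_def)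
      next
        case False
        then show ?thesis using slice_assemble_out[OF False] by (auto simp: slice_\<theta> dsum_family_simps)
      qed
    qed
  qed
  ultimately show ?thesis unfolding isomorphic_cycles_def by blast
qed

section \<open>Fitting decomposition of a cycle\<close>

lemma subspace_dsum:
  assumes "lin_cycle t A" "lin_cycle t B" "i \<in> {1..t}"
  shows "fun_vs.subspace (spc (dsum A B) i)"
proof -
  note A = lin_cycleD[OF assms(1,3)] and B = lin_cycleD[OF assms(2,3)]
  have "lpart (0 :: 'a + 'c \<Rightarrow> 'b) = 0" "rpart (0 :: 'a + 'c \<Rightarrow> 'b) = 0"
    by (auto simp: lpart_def rpart_def fun_eq_iff)
  then show "fun_vs.subspace (spc (dsum A B) i)"
    using A(2) B(2)
    by (intro fun_vs.subspaceI)
      (auto simp: dsum_simps parts_add parts_fscale fun_vs.subspace_0 fun_vs.subspace_add fun_vs.subspace_scale)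
qed

lemma not_nonzero_dim_iff:
  assumes "lin_cycle t A"
  shows "\<not> nonzero_dim t A \<longleftrightarrow> (\<forall>i\<in>{1..t}. spc A i = {0})"
  by (simp add: nonzero_dim_def dim_eq_0_iff[OF lin_cycleD(1)[OF assms]])

text \<open>An internal direct sum decomposition yields an external one: adding the components identifies
  the external sum of the summands with the cycle. The summands enter through injections \<open>b\<close> and
  \<open>c\<close> rather than as subspaces, because later one of them will be a string.\<close>

lemma indecomposable_internal:
  fixes S B C :: "(nat, 'a::real_normed_field) lcycle"
  assumes S: "lin_cycle t S" "indecomposable_cycle t S" and BC: "lin_cycle t B" "lin_cycle t C"
    and b: "\<And>i. i \<in> {1..t} \<Longrightarrow> linear_map_on (spc B i) (spc S i) (b i)"
      "\<And>i x. i \<in> {1..t} \<Longrightarrow> x \<in> spc B i \<Longrightarrow> b (next_vertex t i) (mp B i x) = mp S i (b i x)"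
    and c: "\<And>i. i \<in> {1..t} \<Longrightarrow> linear_map_on (spc C i) (spc S i) (c i)"
      "\<And>i x. i \<in> {1..t} \<Longrightarrow> x \<in> spc C i \<Longrightarrow> c (next_vertex t i) (mp C i x) = mp S i (c i x)"
    and inj: "\<And>i u v. i \<in> {1..t} \<Longrightarrow> u \<in> spc B i \<Longrightarrow> v \<in> spc C i \<Longrightarrow> b i u + c i v = 0 \<Longrightarrow> u = 0 \<and> v = 0"
    and surj: "\<And>i x. i \<in> {1..t} \<Longrightarrow> x \<in> spc S i \<Longrightarrow> \<exists>u\<in>spc B i. \<exists>v\<in>spc C i. x = b i u + c i v"
  shows "(\<forall>i\<in>{1..t}. spc B i = {0}) \<or> (\<forall>i\<in>{1..t}. spc C i = {0})"
proof -
  define h where "h i x = b i (lpart x) + c i (rpart x)" for i x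
  let ?D = "dsum B C"
  have lin: "linear_map_on (spc ?D i) (spc S i) (h i)" if i: "i \<in> {1..t}" for i
    unfolding linear_map_on_def h_def
  proof (intro conjI ballI allI)
    show "(\<lambda>x. b i (lpart x) + c i (rpart x)) \<in> spc ?D i \<rightarrow> spc S i"
      using linear_map_onD(1)[OF b(1)[OF i]] linear_map_onD(1)[OF c(1)[OF i]]
        fun_vs.subspace_add[OF lin_cycleD(2)[OF S(1) i]] by (simp add: dsum_simps)
    fix x assume x: "x \<in> spc ?D i"
    show "b i (lpart (fscale a x)) + c i (rpart (fscale a x)) = fscale a (b i (lpart x) + c i (rpart x))" for a
      using x linear_map_onD(3)[OF b(1)[OF i]] linear_map_onD(3)[OF c(1)[OF i]]
      by (simp add: dsum_simps parts_fscale fun_vs.scale_right_distrib)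
    show "b i (lpart (x + y)) + c i (rpart (x + y)) = b i (lpart x) + c i (rpart x) + (b i (lpart y) + c i (rpart y))"
      if "y \<in> spc ?D i" for y
      using that x linear_map_onD(2)[OF b(1)[OF i]] linear_map_onD(2)[OF c(1)[OF i]]
      by (simp add: dsum_simps parts_add add.assoc add.left_commute)
  qed
  have tr: "transforms t h ?D S"
    unfolding transforms_def
  proof (intro ballI conjI)
    fix i assume i: "i \<in> {1..t}"
    note sub = subspace_dsum[OF BC i]
    show "bij_betw (h i) (spc ?D i) (spc S i)"
      unfolding bij_betw_def
    proof
      show "inj_on (h i) (spc ?D i)"
      proof (rule inj_onI)
        fix x y assume xy: "x \<in> spc ?D i" "y \<in> spc ?D i" "h i x = h i y"
        have "h i (x - y) = 0"
          using linear_map_on_diff[OF lin[OF i] sub xy(1,2)] xy(3) by simp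
        moreover have "x - y \<in> spc ?D i" using fun_vs.subspace_diff[OF sub xy(1,2)] .
        ultimately have "lpart (x - y) = 0 \<and> rpart (x - y) = 0"
          unfolding h_def using inj[OF i, of "lpart (x - y)" "rpart (x - y)"] by (simp add: dsum_simps)
        moreover have "lpart (x - y) = lpart x - lpart y" "rpart (x - y) = rpart x - rpart y"
          by (auto simp: lpart_def rpart_def fun_eq_iff)
        ultimately show "x = y" by (intro sum_type_fun_eqI) auto
      qed
      show "h i ` spc ?D i = spc S i"
      proof
        show "h i ` spc ?D i \<subseteq> spc S i" using linear_map_onD(1)[OF lin[OF i]] by blast
        show "spc S i \<subseteq> h i ` spc ?D i"
        proof
          fix x assume "x \<in> spc S i"
          then obtain u v where uv: "u \<in> spc B i" "v \<in> spc C i" "x = b i u + c i v"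
            using surj[OF i] by blast
          then have "x = h i (join u v)" "join u v \<in> spc ?D i" by (simp_all add: h_def dsum_simps)
          then show "x \<in> h i ` spc ?D i" by blast
        qed
      qed
    qed
    fix x assume x: "x \<in> spc ?D i"
    then have "lpart x \<in> spc B i" "rpart x \<in> spc C i" by (simp_all add: dsum_simps)
    then show "h (next_vertex t i) (mp ?D i x) = mp S i (h i x)"
      using b(2)[OF i] c(2)[OF i] linear_map_onD(1)[OF b(1)[OF i]] linear_map_onD(1)[OF c(1)[OF i]]
        linear_map_onD(2)[OF lin_cycleD(3)[OF S(1) i]]
      by (simp add: h_def dsum_simps)
  qed
  have "isomorphic_cycles t ?D S" unfolding isomorphic_cycles_def using lin tr by blast
  then have "isomorphic_cycles t S ?D"
    by (rule isomorphic_cycles_sym[OF _ subspace_dsum[OF BC] dsum_closed[OF lin_cycle_closed[OF BC(1)] lin_cycle_closed[OF BC(2)]]])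
  then have "\<not> nonzero_dim t B \<or> \<not> nonzero_dim t C"
    using S(2) BC unfolding indecomposable_cycle_def by blast
  then show ?thesis using not_nonzero_dim_iff BC by blast
qed

definition subcycle :: "('i, 'a) lcycle \<Rightarrow> (nat \<Rightarrow> ('i \<Rightarrow> 'a) set) \<Rightarrow> ('i, 'a) lcycle" where
  "subcycle A U = \<lparr>spc = U, mp = mp A\<rparr>"

lemma subcycle_simps [simp]: "spc (subcycle A U) = U" "mp (subcycle A U) = mp A"
  by (simp_all add: subcycle_def)

lemma lin_cycle_subcycle:
  assumes A: "lin_cycle t A"
    and U: "\<And>i. i \<in> {1..t} \<Longrightarrow> fun_vs.subspace (U i)" "\<And>i. i \<in> {1..t} \<Longrightarrow> U i \<subseteq> spc A i"
      "\<And>i x. i \<in> {1..t} \<Longrightarrow> x \<in> U i \<Longrightarrow> mp A i x \<in> U (next_vertex t i)"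
  shows "lin_cycle t (subcycle A U)"
  unfolding lin_cycle_def
proof (intro ballI conjI)
  fix i assume i: "i \<in> {1..t}"
  show "fin_dim_space (spc (subcycle A U) i)"
    using fin_dim_space_subset[OF lin_cycleD(1)[OF A i] U(1,2)[OF i]] by simp
  show "linear_map_on (spc (subcycle A U) i) (spc (subcycle A U) (next_vertex t i)) (mp (subcycle A U) i)"
    using linear_map_on_subset[OF lin_cycleD(3)[OF A i] U(2)[OF i]] U(3)[OF i] by (simp add: image_subset_iff)
qed

text \<open>The kernels of the powers of the return map of a vertex increase and the images decrease, and
  both chains become stationary; finitely many vertices have a common bound. The exponent is
  chosen positive so that a walk of this length contains at least one mapping.\<close>

lemma fitting_exponent:
  fixes S :: "('i, 'a::real_normed_field) lcycle"
  assumes S: "lin_cycle t S"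
  obtains N where "N > 0"
    "\<And>i x. i \<in> {1..t} \<Longrightarrow> x \<in> spc S i \<Longrightarrow> walk t S i (2 * N * t) x = 0 \<Longrightarrow> walk t S i (N * t) x = 0"
    "\<And>i. i \<in> {1..t} \<Longrightarrow> walk t S i (N * t) ` spc S i \<subseteq> walk t S i (2 * N * t) ` spc S i"
proof -
  define K where "K i n = {x \<in> spc S i. walk t S i (n * t) x = 0}" for i n
  define I where "I i n = walk t S i (n * t) ` spc S i" for i n
  have "\<exists>N. \<forall>n\<ge>N. K i n = K i N \<and> I i n = I i N" if i: "i \<in> {1..t}" for i
  proof -
    have lin: "linear_map_on (spc S i) (spc S i) (walk t S i (n * t))" for n
      using walk_linear[OF S i, of "n * t"] vtx_mult[OF i] by simp
    note sub = lin_cycleD(2)[OF S i] and fin = lin_cycleD(1)[OF S i]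
    have step: "walk t S i (Suc n * t) x = walk t S i (n * t) (walk t S i t x)"
      "walk t S i (Suc n * t) x = walk t S i t (walk t S i (n * t) x)" for n x
      using walk_add[of t S i t "n * t" x] walk_add[of t S i "n * t" t x]
        vtx_mult[OF i] vtx_period[OF i] by (simp_all add: add.commute)
    have "\<exists>N. \<forall>n\<ge>N. K i n = K i N"
    proof (rule increasing_chain_stable[OF fin])
      show "fun_vs.subspace (K i n)" for n
        unfolding K_def by (rule linear_map_on_kernel_subspace[OF lin sub])
      show "K i n \<subseteq> K i (Suc n)" for n
        using step(2) walk_zero[OF S i, of t] by (auto simp: K_def)
    qed (auto simp: K_def)
    then obtain N1 where N1: "\<And>n. n \<ge> N1 \<Longrightarrow> K i n = K i N1" by blast
    have "\<exists>N. \<forall>n\<ge>N. I i n = I i N"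
    proof (rule decreasing_chain_stable)
      show "fin_dim_space (I i n)" for n
        unfolding I_def by (rule fin_dim_space_image[OF fin lin])
      show "I i (Suc n) \<subseteq> I i n" for n
        unfolding I_def step(1) using walk_in[OF S i, of _ t] vtx_period[OF i] by auto
    qed
    then obtain N2 where N2: "\<And>n. n \<ge> N2 \<Longrightarrow> I i n = I i N2" by blast
    show ?thesis
      by (rule exI[of _ "max N1 N2"]) (metis N1 N2 max.bounded_iff max.cobounded1 max.cobounded2)
  qed
  then have "\<forall>i\<in>{1..t}. \<exists>N. \<forall>n\<ge>N. K i n = K i N \<and> I i n = I i N" by blast
  then obtain M where M: "\<And>i n. i \<in> {1..t} \<Longrightarrow> n \<ge> M i \<Longrightarrow> K i n = K i (M i) \<and> I i n = I i (M i)"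
    by metis
  \<comment> \<open>a common bound for all vertices\<close>
  define N where "N = Suc (\<Sum>i\<in>{1..t}. M i)"
  have "K i (2 * N) = K i N \<and> I i (2 * N) = I i N" if i: "i \<in> {1..t}" for i
  proof -
    have "M i \<le> (\<Sum>i\<in>{1..t}. M i)" using i by (intro member_le_sum) auto
    then have "M i \<le> N" "M i \<le> 2 * N" by (auto simp: N_def)
    then show ?thesis using M[OF i] by metis
  qed
  then show ?thesis
    by (intro that[of N]) (auto simp: N_def K_def I_def)
qed

lemma mp_walk_commute: "i \<in> {1..t} \<Longrightarrow> mp S i (walk t S i (N * t) x) = walk t S (next_vertex t i) (N * t) (mp S i x)"
  using walk_Suc'[of t S i "N * t" x] vtx_mult[of i t N] by simp

text \<open>Fitting's lemma, applied to the return maps of all vertices at once. The stable images and the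
  stable kernels are two complementary subcycles. Every mapping is bijective on the stable
  images, so a singular indecomposable cycle is equal to its stable kernel.\<close>

lemma indecomposable_singular_nilpotent:
  fixes S :: "(nat, 'a::real_normed_field) lcycle"
  assumes S: "lin_cycle t S" "indecomposable_cycle t S" "singular_cycle t S"
  obtains N where "\<And>i x. i \<in> {1..t} \<Longrightarrow> x \<in> spc S i \<Longrightarrow> walk t S i N x = 0"
proof -
  obtain N where N: "N > 0"
    "\<And>i x. i \<in> {1..t} \<Longrightarrow> x \<in> spc S i \<Longrightarrow> walk t S i (2 * N * t) x = 0 \<Longrightarrow> walk t S i (N * t) x = 0"
    "\<And>i. i \<in> {1..t} \<Longrightarrow> walk t S i (N * t) ` spc S i \<subseteq> walk t S i (2 * N * t) ` spc S i"
    using fitting_exponent[OF S(1)] by metis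
  define R where "R i = walk t S i (N * t) ` spc S i" for i
  define K where "K i = {x \<in> spc S i. walk t S i (N * t) x = 0}" for i
  have lin: "linear_map_on (spc S i) (spc S i) (walk t S i (N * t))" if "i \<in> {1..t}" for i
    using walk_linear[OF S(1) that, of "N * t"] vtx_mult[OF that] by simp
  have double: "walk t S i (2 * N * t) x = walk t S i (N * t) (walk t S i (N * t) x)" if "i \<in> {1..t}" for i x
    using walk_add[of t S i "N * t" "N * t" x] vtx_mult[OF that] by (simp add: mult_2 add_mult_distrib)
  have RS: "R i \<subseteq> spc S i" if "i \<in> {1..t}" for i
    unfolding R_def using linear_map_onD(1)[OF lin[OF that]] by blast
  have KS: "K i \<subseteq> spc S i" for i by (auto simp: K_def)
  have linR: "lin_cycle t (subcycle S R)"
  proof (rule lin_cycle_subcycle[OF S(1) _ RS])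
    fix i assume i: "i \<in> {1..t}"
    show "fun_vs.subspace (R i)"
      unfolding R_def by (rule linear_map_on_image_subspace[OF lin[OF i] lin_cycleD(2)[OF S(1) i]])
    show "mp S i x \<in> R (next_vertex t i)" if x: "x \<in> R i" for x
    proof -
      obtain z where "z \<in> spc S i" "x = walk t S i (N * t) z" using x by (auto simp: R_def)
      then show ?thesis
        using lin_cycleD(4)[OF S(1) i, of z] mp_walk_commute[OF i, of S N z] by (simp add: R_def)
    qed
  qed
  have linK: "lin_cycle t (subcycle S K)"
  proof (rule lin_cycle_subcycle[OF S(1) _ KS])
    fix i assume i: "i \<in> {1..t}"
    show "fun_vs.subspace (K i)"
      unfolding K_def by (rule linear_map_on_kernel_subspace[OF lin[OF i] lin_cycleD(2)[OF S(1) i]])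
    show "mp S i x \<in> K (next_vertex t i)" if "x \<in> K i" for x
      using that lin_cycleD(4)[OF S(1) i] mp_walk_commute[OF i, of S N x]
        linear_map_on_zero[OF lin_cycleD(3,2)[OF S(1) i]] by (auto simp: K_def)
  qed
  have incl: "linear_map_on U V (\<lambda>x. x)" if "U \<subseteq> V" for U V :: "(nat \<Rightarrow> 'a) set"
    using that by (auto simp: linear_map_on_def)
  have sum: "\<exists>u\<in>R i. \<exists>v\<in>K i. x = u + v" if i: "i \<in> {1..t}" and x: "x \<in> spc S i" for i x
  proof -
    obtain z where z: "z \<in> spc S i" "walk t S i (N * t) x = walk t S i (2 * N * t) z"
      using N(3)[OF i] x by blast
    let ?u = "walk t S i (N * t) z"
    have u: "?u \<in> R i" "?u \<in> spc S i" using z RS[OF i] by (auto simp: R_def)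
    have "walk t S i (N * t) (x - ?u) = 0"
      using linear_map_on_diff[OF lin[OF i] lin_cycleD(2)[OF S(1) i] x u(2)] z(2) double[OF i] by simp
    then have "x - ?u \<in> K i"
      using fun_vs.subspace_diff[OF lin_cycleD(2)[OF S(1) i] x u(2)] by (simp add: K_def)
    moreover have "x = ?u + (x - ?u)" by simp
    ultimately show ?thesis using u(1) by blast
  qed
  have inter: "x = 0" if i: "i \<in> {1..t}" and x: "x \<in> R i" "x \<in> K i" for i x
  proof -
    obtain z where z: "z \<in> spc S i" "x = walk t S i (N * t) z" using x by (auto simp: R_def)
    then show ?thesis using N(2)[OF i z(1)] double[OF i] x(2) by (simp add: K_def)
  qed
  have "(\<forall>i\<in>{1..t}. R i = {0}) \<or> (\<forall>i\<in>{1..t}. K i = {0})"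
  proof -
    have "(\<forall>i\<in>{1..t}. spc (subcycle S R) i = {0}) \<or> (\<forall>i\<in>{1..t}. spc (subcycle S K) i = {0})"
    proof (rule indecomposable_internal[OF S(1,2) linR linK, where b = "\<lambda>_ x. x" and c = "\<lambda>_ x. x"])
      fix i u v assume i: "i \<in> {1..t}" and uv: "u \<in> spc (subcycle S R) i" "v \<in> spc (subcycle S K) i" "u + v = 0"
      have v: "v = - u" using uv(3) by (metis minus_unique)
      have "- v \<in> K i" using fun_vs.subspace_neg[OF lin_cycleD(2)[OF linK i]] uv(2) by simp
      then have "u = 0" using inter[OF i] uv(1) v by simp
      then show "u = 0 \<and> v = 0" using v by simp
    qed (use incl RS KS sum in auto)
    then show ?thesis by simp
  qed
  then show ?thesis
  proof
    assume R0: "\<forall>i\<in>{1..t}. R i = {0}"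
    show ?thesis
    proof (rule that[of "N * t"])
      fix i x assume "i \<in> {1..t}" "x \<in> spc S i"
      then show "walk t S i (N * t) x = 0" using R0 unfolding R_def by blast
    qed
  next
    assume K0: "\<forall>i\<in>{1..t}. K i = {0}"
    have "regular_cycle t S"
      unfolding regular_cycle_def
    proof
      fix i assume i: "i \<in> {1..t}"
      note ni = next_vertex_in[OF i]
      have "N * t > 0" using N(1) i by auto
      then obtain n where n: "N * t = Suc n" using gr0_conv_Suc by blast
      have inj: "inj_on (mp S i) (spc S i)"
      proof (rule inj_onI)
        fix x y assume xy: "x \<in> spc S i" "y \<in> spc S i" "mp S i x = mp S i y"
        have "x - y \<in> spc S i" using fun_vs.subspace_diff[OF lin_cycleD(2)[OF S(1) i] xy(1,2)] .
        moreover have "walk t S i (N * t) (x - y) = 0"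
          unfolding n walk_Suc' linear_map_on_diff[OF lin_cycleD(3,2)[OF S(1) i] xy(1,2)]
          using xy(3) walk_zero[OF S(1) ni] by simp
        ultimately have "x - y \<in> K i" by (simp add: K_def)
        then show "x = y" using K0 i by simp
      qed
      have "spc S (next_vertex t i) \<subseteq> mp S i ` spc S i"
      proof
        fix y assume "y \<in> spc S (next_vertex t i)"
        then obtain u v where uv: "u \<in> R (next_vertex t i)" "v \<in> K (next_vertex t i)" "y = u + v"
          using sum[OF ni] by blast
        have "v = 0" using uv(2) K0[rule_format, OF ni] by simp
        then have "y \<in> R (next_vertex t i)" using uv by simp
        then obtain z where z: "z \<in> spc S (next_vertex t i)" "y = walk t S (next_vertex t i) (N * t) z"
          by (auto simp: R_def)
        have v: "vtx t (next_vertex t i) n = i" using n vtx_mult[OF i, of N] by (simp add: vtx_Suc')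
        then have "y = mp S i (walk t S (next_vertex t i) n z)" using z(2) n by simp
        then show "y \<in> mp S i ` spc S i" using walk_in[OF S(1) ni z(1), of n] v by auto
      qed
      then show "bij_betw (mp S i) (spc S i) (spc S (next_vertex t i))"
        using inj lin_cycleD(4)[OF S(1) i] by (auto simp: bij_betw_def)
    qed
    then show ?thesis using S(3) by blast
  qed
qed

section \<open>Indecomposable nilpotent cycles\<close>

text \<open>The vector \<open>x\<close> has coefficients \<open>x q\<close> with respect to a basis of \<open>l\<close> vectors \<open>e\<^sub>0, e\<^sub>1, \<dots>\<close>, the
  one with number \<open>q\<close> living at the vertex reached from \<open>i\<close> in \<open>q\<close> steps. The mappings send each basis
  vector to the next one and the last one to zero: this is the Jordan block of the cycle.\<close>

definition string_cycle :: "nat \<Rightarrow> nat \<Rightarrow> nat \<Rightarrow> (nat, 'a::real_normed_field) lcycle" where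
  "string_cycle t i l =
     \<lparr>spc = \<lambda>j. {x. \<forall>q. x q \<noteq> 0 \<longrightarrow> q < l \<and> vtx t i q = j},
      mp = \<lambda>j x q. if 0 < q \<and> q < l then x (q - 1) else 0\<rparr>"

lemma string_cycle_simps:
  "spc (string_cycle t i l) j = {x. \<forall>q. x q \<noteq> 0 \<longrightarrow> q < l \<and> vtx t i q = j}"
  "mp (string_cycle t i l) j x q = (if 0 < q \<and> q < l then x (q - 1) else 0)"
  by (simp_all add: string_cycle_def)

lemma string_cycle_spc_supported: "spc (string_cycle t i l) j = supported_on {q. q < l \<and> vtx t i q = j}"
  by (auto simp: string_cycle_simps supported_on_def)

lemma lin_cycle_string:
  "lin_cycle t (string_cycle t i l :: (nat, 'a::real_normed_field) lcycle)"
  unfolding lin_cycle_def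
proof (intro ballI conjI)
  fix j
  let ?A = "string_cycle t i l :: (nat, 'a) lcycle"
  show "fin_dim_space (spc ?A j)"
    unfolding string_cycle_spc_supported by (rule fin_dim_space_supported_on) simp
  have "mp ?A j x \<in> spc ?A (next_vertex t j)" if x: "x \<in> spc ?A j" for x
    unfolding string_cycle_simps(1)
  proof (intro CollectI allI impI)
    fix q assume "mp ?A j x q \<noteq> 0"
    then have q: "0 < q" "q < l" "x (q - 1) \<noteq> 0" by (auto simp: string_cycle_simps split: if_splits)
    then have "vtx t i (q - 1) = j" using x by (simp add: string_cycle_simps)
    moreover have "vtx t i q = next_vertex t (vtx t i (q - 1))" using q(1) by (cases q) auto
    ultimately show "q < l \<and> vtx t i q = next_vertex t j" using q by simp
  qed
  then show "linear_map_on (spc ?A j) (spc ?A (next_vertex t j)) (mp ?A j)"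
    unfolding linear_map_on_def by (auto simp: fun_eq_iff fscale_apply string_cycle_simps(2))
qed

text \<open>Take a walk of maximal length \<open>l - 1\<close> that does not annihilate some vector \<open>v\<close>, and a
  coordinate \<open>k0\<close> at which the end of the walk is nonzero. The vectors visited by the walk from
  \<open>v\<close> form a string. A complementary subcycle \<open>W\<close> consists of the vectors all of whose walks to the
  final vertex \<open>z\<close> have \<open>k0\<close>-coordinate zero: on the string these conditions are triangular with
  nonzero diagonal, so they meet it trivially, and they can be enforced on any vector by
  subtracting an element of the string. Indecomposability leaves no room for \<open>W\<close>.\<close>

lemma indecomposable_nilpotent_string:
  fixes S :: "(nat, 'a::real_normed_field) lcycle"
  assumes S: "lin_cycle t S" "indecomposable_cycle t S"
    and nil: "\<And>i x. i \<in> {1..t} \<Longrightarrow> x \<in> spc S i \<Longrightarrow> walk t S i N x = 0"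
  obtains i l where "i \<in> {1..t}" "0 < l" "isomorphic_cycles t (string_cycle t i l) S"
proof -
  define P where "P l \<longleftrightarrow> (\<forall>i\<in>{1..t}. \<forall>x\<in>spc S i. walk t S i l x = 0)" for l
  define l where "l = (LEAST l. P l)"
  have "P N" using nil by (auto simp: P_def)
  then have Pl: "P l" unfolding l_def by (rule LeastI)
  have notP: "\<not> P m" if "m < l" for m using that not_less_Least unfolding l_def by blast
  have "nonzero_dim t S" using S(2) by (simp add: indecomposable_cycle_def)
  then have "\<not> (\<forall>i\<in>{1..t}. spc S i = {0})" using not_nonzero_dim_iff[OF S(1)] by blast
  then have l0: "0 < l"
    using Pl lin_cycleD(2)[OF S(1)] fun_vs.subspace_0 by (cases l) (fastforce simp: P_def)+
  then obtain i0 v where i0: "i0 \<in> {1..t}" and v: "v \<in> spc S i0" and "walk t S i0 (l - 1) v \<noteq> 0"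
    using notP[of "l - 1"] by (auto simp: P_def simp del: atLeastAtMost_iff)
  then obtain k0 where k0: "walk t S i0 (l - 1) v k0 \<noteq> 0" by (auto simp: fun_eq_iff)
  define a where "a = walk t S i0 (l - 1) v k0"
  have a: "a \<noteq> 0" using k0 by (simp add: a_def)
  define z where "z = vtx t i0 (l - 1)"
  define e where "e q = walk t S i0 q v" for q
  have eS: "e q \<in> spc S (vtx t i0 q)" for q unfolding e_def by (rule walk_in[OF S(1) i0 v])
  have walk_e: "walk t S (vtx t i0 q) k (e q) = e (q + k)" for q k
    unfolding e_def by (simp add: walk_add)
  have vanish: "walk t S i k x = 0" if "l \<le> k" "i \<in> {1..t}" "x \<in> spc S i" for i k x
  proof -
    have "walk t S i k x = walk t S (vtx t i l) (k - l) (walk t S i l x)"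
      using walk_add[of t S i l "k - l" x] that(1) by simp
    moreover have "walk t S i l x = 0" using Pl that by (auto simp: P_def)
    ultimately show ?thesis using walk_zero[OF S(1) vtx_in[OF that(2)]] by metis
  qed
  have e_l: "e q = 0" if "l \<le> q" for q
    unfolding e_def by (rule vanish[OF that i0 v])
  let ?T = "string_cycle t i0 l :: (nat, 'a) lcycle"
  define b where "b x = (\<Sum>q<l. fscale (x q) (e q))" for x :: "nat \<Rightarrow> 'a"
  have term_in: "fscale (x q) (e q) \<in> spc S i" if "i \<in> {1..t}" "x \<in> spc ?T i" for i x q
  proof (cases "x q = 0")
    case True
    then show ?thesis using fun_vs.subspace_0[OF lin_cycleD(2)[OF S(1) that(1)]] by simp
  next
    case False
    then have "vtx t i0 q = i" using that(2) by (simp add: string_cycle_simps)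
    then show ?thesis using eS[of q] fun_vs.subspace_scale[OF lin_cycleD(2)[OF S(1) that(1)]] by metis
  qed
  have b_in: "b x \<in> spc S i" if "i \<in> {1..t}" "x \<in> spc ?T i" for i x
    unfolding b_def using term_in[OF that]
    by (intro fun_vs.subspace_sum[OF lin_cycleD(2)[OF S(1) that(1)]]) auto
  have walk_b: "walk t S i k (b x) = (\<Sum>q<l. fscale (x q) (e (q + k)))"
    if i: "i \<in> {1..t}" and x: "x \<in> spc ?T i" for i k x
  proof -
    note lin = walk_linear[OF S(1) i, of k] and sub = lin_cycleD(2)[OF S(1) i]
    have "walk t S i k (b x) = (\<Sum>q<l. walk t S i k (fscale (x q) (e q)))"
      unfolding b_def by (rule linear_map_on_sum[OF lin sub term_in[OF i x]])
    also have "\<dots> = (\<Sum>q<l. fscale (x q) (e (q + k)))"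
    proof (rule sum.cong[OF refl])
      fix q
      show "walk t S i k (fscale (x q) (e q)) = fscale (x q) (e (q + k))"
      proof (cases "x q = 0")
        case True
        then show ?thesis using walk_zero[OF S(1) i] by simp
      next
        case False
        then have "vtx t i0 q = i" using x by (simp add: string_cycle_simps)
        then show ?thesis using linear_map_onD(3)[OF lin] eS[of q] walk_e[of q k] by metis
      qed
    qed
    finally show ?thesis .
  qed
  have b_add: "b (x + y) = b x + b y" for x y
    unfolding b_def sum.distrib[symmetric]
    by (intro sum.cong refl) (simp add: fun_vs.scale_left_distrib)
  have b_scale: "b (fscale c x) = fscale c (b x)" for c x
    unfolding b_def fun_vs.scale_sum_right by (intro sum.cong refl) (simp add: fscale_apply)
  have b_lin: "linear_map_on (spc ?T i) (spc S i) b" if "i \<in> {1..t}" for i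
    unfolding linear_map_on_def using b_in[OF that] b_add b_scale by blast
  have b_comm: "b (mp ?T i x) = mp S i (b x)" if i: "i \<in> {1..t}" and x: "x \<in> spc ?T i" for i x
  proof -
    obtain m where m: "l = Suc m" using l0 gr0_conv_Suc by blast
    have "mp S i (b x) = (\<Sum>q<l. fscale (x q) (e (Suc q)))"
      using walk_b[OF i x, of 1] by simp
    also have "\<dots> = (\<Sum>q<m. fscale (x q) (e (Suc q)))"
      using e_l[of "Suc m"] by (simp add: m)
    also have "\<dots> = b (mp ?T i x)"
      unfolding b_def m sum.lessThan_Suc_shift by (simp add: string_cycle_simps(2))
    finally show ?thesis ..
  qed
  define W where "W i = {x \<in> spc S i. \<forall>k. vtx t i k = z \<longrightarrow> walk t S i k x k0 = 0}" for i
  have WS: "W i \<subseteq> spc S i" for i by (auto simp: W_def)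
  have linW: "lin_cycle t (subcycle S W)"
  proof (rule lin_cycle_subcycle[OF S(1) _ WS])
    fix i assume i: "i \<in> {1..t}"
    note sub = lin_cycleD(2)[OF S(1) i] and lin = walk_linear[OF S(1) i]
    show "fun_vs.subspace (W i)"
      by (rule fun_vs.subspaceI)
        (auto simp: W_def fun_vs.subspace_0[OF sub] fun_vs.subspace_add[OF sub] fun_vs.subspace_scale[OF sub]
          linear_map_onD[OF lin] walk_zero[OF S(1) i] fscale_apply)
    show "mp S i x \<in> W (next_vertex t i)" if x: "x \<in> W i" for x
    proof -
      have "walk t S (next_vertex t i) k (mp S i x) k0 = 0" if "vtx t (next_vertex t i) k = z" for k
      proof -
        have "vtx t i (Suc k) = z" using that by (simp only: vtx_Suc')
        then have "walk t S i (Suc k) x k0 = 0" using x unfolding W_def by blast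
        then show ?thesis by (simp only: walk_Suc')
      qed
      then show ?thesis using lin_cycleD(4)[OF S(1) i] x by (auto simp: W_def)
    qed
  qed
  \<comment> \<open>test \<open>u\<close> with the walk that carries its first nonzero term to the end of the string; it
    annihilates all later terms\<close>
  have trivial: "u = 0" if i: "i \<in> {1..t}" and u: "u \<in> spc ?T i" and w: "w \<in> W i" and 0: "b u + w = 0" for i u w
  proof (rule ccontr)
    assume "u \<noteq> 0"
    then obtain q' where "u q' \<noteq> 0" by (auto simp: fun_eq_iff)
    define q where "q = (LEAST q. u q \<noteq> 0)"
    have q: "u q \<noteq> 0" unfolding q_def by (rule LeastI[of "\<lambda>q. u q \<noteq> 0", OF \<open>u q' \<noteq> 0\<close>])
    have less: "u p = 0" if "p < q" for p using that not_less_Least unfolding q_def by blast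
    have ql: "q < l" "vtx t i0 q = i" using u q by (auto simp: string_cycle_simps)
    define k where "k = l - 1 - q"
    have qk: "q + k = l - 1" using ql by (simp add: k_def)
    have "vtx t i k = z" using vtx_vtx[where i = i0 and k = q and l = k and t = t] ql(2) qk by (simp add: z_def)
    then have "walk t S i k w k0 = 0" using w by (simp add: W_def)
    moreover have "walk t S i k (b u) + walk t S i k w = 0"
      using linear_map_onD(2)[OF walk_linear[OF S(1) i, of k] b_in[OF i u]] w WS 0 walk_zero[OF S(1) i, of k]
      by (metis subsetD)
    ultimately have "walk t S i k (b u) k0 = 0" by (metis add.right_neutral plus_fun_apply zero_fun_apply)
    moreover have "walk t S i k (b u) k0 = (\<Sum>p<l. if p = q then u q * a else 0)"
      unfolding walk_b[OF i u] sum_fun_apply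
    proof (rule sum.cong[OF refl])
      fix p
      consider "p < q" | "p = q" | "q < p" by linarith
      then show "fscale (u p) (e (p + k)) k0 = (if p = q then u q * a else 0)"
      proof cases
        case 1
        then show ?thesis using less by (simp add: fscale_apply)
      next
        case 2
        then show ?thesis using qk by (simp add: fscale_apply a_def e_def)
      next
        case 3
        then have "l \<le> p + k" using qk l0 by simp
        then show ?thesis using 3 e_l by (simp add: fscale_apply)
      qed
    qed
    ultimately show False using ql q a by simp
  qed
  \<comment> \<open>the conditions are met from the longest walks downwards: subtracting a multiple of the basis
    vector number \<open>m\<close> corrects the walk of length \<open>l - 1 - m\<close> and does not affect longer ones\<close>
  have reduce: "\<exists>u\<in>spc ?T i. \<forall>k. vtx t i k = z \<and> l \<le> m + k \<longrightarrow> walk t S i k (x - b u) k0 = 0"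
    if i: "i \<in> {1..t}" and x: "x \<in> spc S i" and "m \<le> l" for i x m
    using \<open>m \<le> l\<close>
  proof (induction m)
    case 0
    have "b 0 = 0" by (simp add: b_def)
    moreover have "0 \<in> spc ?T i" by (simp add: string_cycle_simps)
    moreover have "x - 0 = x" by simp
    ultimately show ?case using vanish[OF _ i x] by (metis add_0 zero_fun_apply)
  next
    case (Suc m)
    obtain u where u: "u \<in> spc ?T i"
      and uk: "\<And>k. vtx t i k = z \<Longrightarrow> l \<le> m + k \<Longrightarrow> walk t S i k (x - b u) k0 = 0"
      using Suc.IH[OF Suc_leD[OF Suc.prems]] by blast
    define k1 where "k1 = l - Suc m"
    have mk1: "m + k1 = l - 1" using Suc.prems by (simp add: k1_def)
    show ?case
    proof (cases "vtx t i k1 = z")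
      case False
      have "walk t S i k (x - b u) k0 = 0" if "vtx t i k = z" "l \<le> Suc m + k" for k
      proof -
        have "k \<noteq> k1" using that False by blast
        then show ?thesis using uk[of k] that mk1 by simp
      qed
      then show ?thesis using u by blast
    next
      case True
      have im: "vtx t i0 m = i"
      proof (rule vtx_inj[OF vtx_in[OF i0] i])
        show "vtx t (vtx t i0 m) k1 = vtx t i k1"
          unfolding vtx_vtx mk1 True z_def ..
      qed
      define c where "c = walk t S i k1 (x - b u) k0 / a"
      define d :: "nat \<Rightarrow> 'a" where "d q = (if q = m then c else 0)" for q
      have dT: "d \<in> spc ?T i" using im Suc.prems by (auto simp: string_cycle_simps d_def)
      have bd: "b d = fscale c (e m)"
      proof -
        have "b d = (\<Sum>q<l. if q = m then fscale c (e m) else 0)"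
          unfolding b_def by (rule sum.cong) (auto simp: d_def)
        then show ?thesis using Suc.prems by simp
      qed
      have udT: "u + d \<in> spc ?T i" using fun_vs.subspace_add[OF lin_cycleD(2)[OF lin_cycle_string i] u dT] .
      note sub = lin_cycleD(2)[OF S(1) i]
      have xb: "x - b u \<in> spc S i" using fun_vs.subspace_diff[OF sub x b_in[OF i u]] .
      have "walk t S i k (x - b (u + d)) k0 = 0" if k: "vtx t i k = z" "l \<le> Suc m + k" for k
      proof -
        have split: "x - b (u + d) = (x - b u) - b d" by (simp only: b_add diff_diff_eq)
        have "walk t S i k (x - b (u + d)) = walk t S i k (x - b u) - walk t S i k (b d)"
          unfolding split by (rule linear_map_on_diff[OF walk_linear[OF S(1) i] sub xb b_in[OF i dT]])
        also have "walk t S i k (b d) = fscale c (e (m + k))"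
          unfolding bd using linear_map_onD(3)[OF walk_linear[OF S(1) i, of k]] eS[of m] walk_e[of m k] im by metis
        finally have "walk t S i k (x - b (u + d)) = walk t S i k (x - b u) - fscale c (e (m + k))" .
        from fun_cong[OF this, of k0]
        have eq: "walk t S i k (x - b (u + d)) k0 = walk t S i k (x - b u) k0 - c * e (m + k) k0"
          by (simp add: fscale_apply)
        show ?thesis
        proof (cases "k = k1")
          case True
          then show ?thesis unfolding eq using mk1 a by (simp add: c_def a_def e_def)
        next
          case False
          then have "l \<le> m + k" using k(2) mk1 by simp
          then show ?thesis unfolding eq using uk[OF k(1)] e_l by simp
        qed
      qed
      then show ?thesis using udT by blast
    qed
  qed
  have decomp: "\<exists>u\<in>spc ?T i. \<exists>w\<in>W i. x = b u + w" if i: "i \<in> {1..t}" and x: "x \<in> spc S i" for i x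
  proof -
    obtain u where u: "u \<in> spc ?T i" "\<And>k. vtx t i k = z \<Longrightarrow> walk t S i k (x - b u) k0 = 0"
      using reduce[OF i x order_refl] by auto
    have "x - b u \<in> spc S i"
      using fun_vs.subspace_diff[OF lin_cycleD(2)[OF S(1) i] x b_in[OF i u(1)]] .
    then have "x - b u \<in> W i" using u(2) by (simp add: W_def)
    moreover have "x = b u + (x - b u)" by simp
    ultimately show ?thesis using u(1) by blast
  qed
  have W_incl: "linear_map_on (W i) (spc S i) (\<lambda>x. x)" for i
    using WS[of i] by (auto simp: linear_map_on_def)
  have "(\<forall>i\<in>{1..t}. spc ?T i = {0}) \<or> (\<forall>i\<in>{1..t}. spc (subcycle S W) i = {0})"
  proof (rule indecomposable_internal[OF S lin_cycle_string linW, where b = "\<lambda>_. b" and c = "\<lambda>_ x. x"])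
    fix i u v assume i: "i \<in> {1..t}" and uv: "u \<in> spc ?T i" "v \<in> spc (subcycle S W) i" "b u + v = 0"
    then have "u = 0" using trivial by simp
    moreover have "b 0 = 0" by (simp add: b_def)
    ultimately show "u = 0 \<and> v = 0" using uv(3) by simp
  qed (use b_lin b_comm decomp W_incl in simp_all)
  moreover have "spc ?T i0 \<noteq> {0}"
  proof -
    have "(\<lambda>q. if q = 0 then 1 else 0) \<in> spc ?T i0" using l0 by (simp add: string_cycle_simps)
    moreover have "(\<lambda>q::nat. if q = 0 then 1 else 0) \<noteq> (0 :: nat \<Rightarrow> 'a)" by (auto simp: fun_eq_iff)
    ultimately show ?thesis by blast
  qed
  ultimately have W0: "W i = {0}" if "i \<in> {1..t}" for i using i0 that by auto
  have "bij_betw b (spc ?T i) (spc S i)" if i: "i \<in> {1..t}" for i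
    unfolding bij_betw_def
  proof
    note subT = lin_cycleD(2)[OF lin_cycle_string i, of i0 l]
    show "inj_on b (spc ?T i)"
    proof (rule inj_onI)
      fix x y assume xy: "x \<in> spc ?T i" "y \<in> spc ?T i" "b x = b y"
      have "b (x - y) + 0 = 0" using linear_map_on_diff[OF b_lin[OF i] subT xy(1,2)] xy(3) by simp
      then have "x - y = 0"
        using trivial[OF i fun_vs.subspace_diff[OF subT xy(1,2)]] W0[OF i] by blast
      then show "x = y" by simp
    qed
    show "b ` spc ?T i = spc S i"
    proof
      show "b ` spc ?T i \<subseteq> spc S i" using b_in[OF i] by blast
      show "spc S i \<subseteq> b ` spc ?T i"
      proof
        fix x assume "x \<in> spc S i"
        then obtain u w where uw: "u \<in> spc ?T i" "w \<in> W i" "x = b u + w" using decomp[OF i] by blast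
        have "w = 0" using uw(2) W0[OF i] by simp
        then show "x \<in> b ` spc ?T i" using uw by simp
      qed
    qed
  qed
  then have "isomorphic_cycles t ?T S"
    unfolding isomorphic_cycles_def transforms_def
    using b_lin b_comm by (intro exI[of _ "\<lambda>_. b"]) blast
  then show ?thesis using that i0 l0 by blast
qed

section \<open>Images of walks in a regular cycle plus strings\<close>

lemma walk_dsum: "walk t (dsum A B) i n x = join (walk t A i n (lpart x)) (walk t B i n (rpart x))"
  by (induction n) (simp_all add: dsum_simps)

lemma slice_walk_dsum_family:
  "k \<in> {1..r} \<Longrightarrow> slice k (walk t (dsum_family r S) i n x) = walk t (S k) i n (slice k x)"
  by (induction n) (simp_all add: dsum_family_simps del: atLeastAtMost_iff)

lemma walk_string:
  assumes "x \<in> spc (string_cycle t i0 l) i"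
  shows "walk t (string_cycle t i0 l) i n x q = (if n \<le> q \<and> q < l then x (q - n) else 0)"
proof (induction n arbitrary: q)
  case 0
  then show ?case using assms by (auto simp: string_cycle_simps)
next
  case (Suc n)
  then show ?case by (auto simp: string_cycle_simps(2))
qed

lemma regular_walk_bij:
  assumes "regular_cycle t A" "i \<in> {1..t}"
  shows "bij_betw (walk t A i n) (spc A i) (spc A (vtx t i n))"
proof (induction n)
  case 0
  show ?case by (simp add: bij_betw_def)
next
  case (Suc n)
  have "bij_betw (mp A (vtx t i n)) (spc A (vtx t i n)) (spc A (vtx t i (Suc n)))"
    using assms vtx_in[OF assms(2), of n] by (simp add: regular_cycle_def)
  from bij_betw_trans[OF Suc this] show ?case by (simp add: comp_def)
qed

definition strings :: "nat \<Rightarrow> nat \<Rightarrow> (nat \<Rightarrow> nat) \<Rightarrow> (nat \<Rightarrow> nat) \<Rightarrow> (nat \<times> nat, 'a::real_normed_field) lcycle" where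
  "strings t r p L = dsum_family r (\<lambda>k. string_cycle t (p k) (L k))"

text \<open>Positions of the basis vectors that span the image, in a sum of strings, of the \<open>n\<close>-step walk from
  vertex \<open>i\<close>. They are recorded at the end of the walk, where the homeomorphisms act on them.\<close>

definition ends :: "nat \<Rightarrow> nat \<Rightarrow> (nat \<Rightarrow> nat) \<Rightarrow> (nat \<Rightarrow> nat) \<Rightarrow> nat \<Rightarrow> nat \<Rightarrow> (nat \<times> nat) set" where
  "ends t r p L i n = {(k, q). k \<in> {1..r} \<and> n \<le> q \<and> q < L k \<and> vtx t (p k) (q - n) = i}"

lemma finite_ends: "finite (ends t r p L i n)"
proof (rule finite_subset)
  show "ends t r p L i n \<subseteq> (SIGMA k:{1..r}. {..<L k})" by (auto simp: ends_def)
qed simp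

lemma mem_spc_strings:
  "x \<in> spc (strings t r p L) i \<longleftrightarrow> (\<forall>k q. x (k, q) \<noteq> 0 \<longrightarrow> k \<in> {1..r} \<and> q < L k \<and> vtx t (p k) q = i)"
proof -
  have "slice k x = 0 \<longleftrightarrow> (\<forall>q. x (k, q) = 0)" for k by (simp add: slice_def fun_eq_iff)
  then show ?thesis
    unfolding strings_def dsum_family_simps string_cycle_simps mem_Collect_eq slice_def by blast
qed

lemma closed_strings: "closed_cycle t (strings t r p L)"
  unfolding strings_def by (intro dsum_family_closed lin_cycle_closed lin_cycle_string)

lemma mp_strings_zero: "mp (strings t r p L) i 0 = 0"
  by (rule slice_eqI)
    (auto simp: strings_def dsum_family_simps slice_def assemble_def fun_eq_iff string_cycle_simps)

lemma walk_strings: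
  assumes "x \<in> spc (strings t r p L) i" "i \<in> {1..t}"
  shows "walk t (strings t r p L) i n x (k, q) =
    (if k \<in> {1..r} \<and> n \<le> q \<and> q < L k then x (k, q - n) else 0)"
proof (cases "k \<in> {1..r}")
  case True
  have "slice k x \<in> spc (string_cycle t (p k) (L k)) i"
    using assms(1) True by (auto simp: strings_def dsum_family_simps)
  then have "slice k (walk t (strings t r p L) i n x) q = (if n \<le> q \<and> q < L k then slice k x (q - n) else 0)"
    unfolding strings_def slice_walk_dsum_family[OF True] by (rule walk_string)
  then show ?thesis using True by (auto simp: slice_def)
next
  case False
  then show ?thesis
    using walk_closed[OF closed_strings assms(2,1), of n] unfolding mem_spc_strings by auto
qed

lemma walk_image_strings:
  assumes i: "i \<in> {1..t}"
  shows "walk t (strings t r p L) i n ` spc (strings t r p L) i =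
    (supported_on (ends t r p L i n) :: (nat \<times> nat \<Rightarrow> 'a::real_normed_field) set)"
proof
  let ?F = "strings t r p L :: (nat \<times> nat, 'a) lcycle"
  show "walk t ?F i n ` spc ?F i \<subseteq> supported_on (ends t r p L i n)"
  proof
    fix y assume "y \<in> walk t ?F i n ` spc ?F i"
    then obtain x where x: "x \<in> spc ?F i" "y = walk t ?F i n x" by blast
    have "(k, q) \<in> ends t r p L i n" if "y (k, q) \<noteq> 0" for k q
      using that x(1) unfolding x(2) walk_strings[OF x(1) i] mem_spc_strings ends_def
      by (auto split: if_splits)
    then show "y \<in> supported_on (ends t r p L i n)" by (auto simp: supported_on_def)
  qed
  show "supported_on (ends t r p L i n) \<subseteq> walk t ?F i n ` spc ?F i"
  proof
    fix y :: "nat \<times> nat \<Rightarrow> 'a" assume y: "y \<in> supported_on (ends t r p L i n)"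
    define x where "x = (\<lambda>(k, q). y (k, q + n))"
    have x: "x \<in> spc ?F i"
      unfolding mem_spc_strings
    proof (intro allI impI)
      fix k q assume "x (k, q) \<noteq> 0"
      then have "(k, q + n) \<in> ends t r p L i n" using y by (auto simp: x_def supported_on_def)
      then show "k \<in> {1..r} \<and> q < L k \<and> vtx t (p k) q = i" by (auto simp: ends_def)
    qed
    have "y = walk t ?F i n x"
    proof
      fix c :: "nat \<times> nat"
      obtain k q where c: "c = (k, q)" by fastforce
      show "y c = walk t ?F i n x c"
        unfolding c walk_strings[OF x i] using y by (auto simp: x_def supported_on_def ends_def)
    qed
    then show "y \<in> walk t ?F i n ` spc ?F i" using x by blast
  qed
qed

lemma walk_image_dsum:
  "walk t (dsum A B) i n ` spc (dsum A B) i =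
    {y. lpart y \<in> walk t A i n ` spc A i \<and> rpart y \<in> walk t B i n ` spc B i}"
proof
  show "walk t (dsum A B) i n ` spc (dsum A B) i \<subseteq>
      {y. lpart y \<in> walk t A i n ` spc A i \<and> rpart y \<in> walk t B i n ` spc B i}"
    by (auto simp: walk_dsum dsum_simps)
  show "{y. lpart y \<in> walk t A i n ` spc A i \<and> rpart y \<in> walk t B i n ` spc B i} \<subseteq>
      walk t (dsum A B) i n ` spc (dsum A B) i"
  proof
    fix y assume "y \<in> {y. lpart y \<in> walk t A i n ` spc A i \<and> rpart y \<in> walk t B i n ` spc B i}"
    then obtain u v where uv: "u \<in> spc A i" "v \<in> spc B i" "lpart y = walk t A i n u" "rpart y = walk t B i n v"
      by blast
    have "y = walk t (dsum A B) i n (join u v)"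
      by (rule sum_type_fun_eqI) (simp_all add: walk_dsum uv)
    moreover have "join u v \<in> spc (dsum A B) i" using uv by (simp add: dsum_simps)
    ultimately show "y \<in> walk t (dsum A B) i n ` spc (dsum A B) i" by blast
  qed
qed

text \<open>The image of a walk keeps the regular part, on which walks are bijective, and cuts off the
  beginnings of the strings.\<close>

lemma walk_image_regular_strings:
  assumes "regular_cycle t R" "i \<in> {1..t}"
  shows "walk t (dsum R (strings t r p L)) i n ` spc (dsum R (strings t r p L)) i =
    {y. lpart y \<in> spc R (vtx t i n) \<and> rpart y \<in> supported_on (ends t r p L i n)}"
  unfolding walk_image_dsum bij_betw_imp_surj_on[OF regular_walk_bij[OF assms]]
    walk_image_strings[OF assms(2)] ..

section \<open>Topological invariants\<close>

lemma continuous_on_parts: "continuous_on S (lpart :: ('i + 'j \<Rightarrow> 'a::topological_space) \<Rightarrow> _)"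
  "continuous_on S (rpart :: ('i + 'j \<Rightarrow> 'a::topological_space) \<Rightarrow> _)"
  by (rule continuous_on_coordinatewise_then_product, simp add: lpart_def rpart_def continuous_on_coordinate)+

lemma continuous_on_join:
  fixes f :: "'b::topological_space \<Rightarrow> 'i \<Rightarrow> 'a::topological_space" and g :: "'b \<Rightarrow> 'j \<Rightarrow> 'a"
  assumes "continuous_on S f" "continuous_on S g"
  shows "continuous_on S (\<lambda>x. join (f x) (g x))"
proof (rule continuous_on_coordinatewise_then_product)
  fix c :: "'i + 'j"
  show "continuous_on S (\<lambda>x. join (f x) (g x) c)"
    using continuous_on_product_then_coordinatewise[OF assms(1)]
      continuous_on_product_then_coordinatewise[OF assms(2)]
    by (cases c) (simp_all add: join_def)
qed

lemma homeomorphic_dsum_coordinates: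
  fixes U :: "('i \<Rightarrow> 'a::real_normed_field) set" and Q :: "'j set"
  assumes "U homeomorphic (supported_on J :: ('i \<Rightarrow> 'a) set)"
  shows "{y :: 'i + 'j \<Rightarrow> 'a. lpart y \<in> U \<and> rpart y \<in> supported_on Q} homeomorphic
    (supported_on (J <+> Q) :: ('i + 'j \<Rightarrow> 'a) set)"
proof -
  obtain f g where fg: "homeomorphism U (supported_on J :: ('i \<Rightarrow> 'a) set) f g"
    using assms by (auto simp: homeomorphic_def)
  have mem: "y \<in> supported_on (J <+> Q) \<longleftrightarrow> lpart y \<in> supported_on J \<and> rpart y \<in> supported_on Q"
    for y :: "'i + 'j \<Rightarrow> 'a"
    by (auto simp: supported_on_def lpart_def rpart_def split_sum_all)
  let ?S = "{y :: 'i + 'j \<Rightarrow> 'a. lpart y \<in> U \<and> rpart y \<in> supported_on Q}"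
  let ?T = "supported_on (J <+> Q) :: ('i + 'j \<Rightarrow> 'a) set"
  have "homeomorphism ?S ?T (\<lambda>y. join (f (lpart y)) (rpart y)) (\<lambda>y. join (g (lpart y)) (rpart y))"
  proof (rule homeomorphismI)
    show "continuous_on ?S (\<lambda>y. join (f (lpart y)) (rpart y))"
      using fg by (intro continuous_on_join continuous_on_parts
          continuous_on_compose2[of U f, OF _ continuous_on_parts(1)]) (auto simp: homeomorphism_def)
    show "continuous_on ?T (\<lambda>y. join (g (lpart y)) (rpart y))"
      using fg by (intro continuous_on_join continuous_on_parts
          continuous_on_compose2[of "supported_on J" g, OF _ continuous_on_parts(1)])
        (auto simp: homeomorphism_def mem)
  qed (use fg in \<open>auto simp: homeomorphism_def mem\<close>)
  then show ?thesis by (auto simp: homeomorphic_def)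
qed

lemma homeomorphic_supported_onE:
  fixes V :: "('i \<Rightarrow> 'a::real_normed_field) set"
  assumes "fin_dim_space V"
  obtains J where "finite J" "V homeomorphic (supported_on J :: ('i \<Rightarrow> 'a::real_normed_field) set)"
proof -
  obtain J e where P: "pivots V J e" using pivots_exist[OF assms] .
  show ?thesis
  proof (rule that)
    show "finite J" using P by (simp add: pivots_def)
    show "V homeomorphic (supported_on J :: ('i \<Rightarrow> 'a) set)"
      using homeomorphic_supported_on_pivots[OF fin_dim_space_subspace[OF assms] P]
      by (auto simp: homeomorphic_def)
  qed
qed

text \<open>A transformation intertwines walks, so it matches their images, whether or not it is linear.\<close>

lemma top_equiv_walk_image:
  assumes "transforms t \<phi> A B" "closed_cycle t A" "i \<in> {1..t}"
  shows "\<phi> (vtx t i n) ` (walk t A i n ` spc A i) = walk t B i n ` spc B i"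
proof -
  have "\<phi> (vtx t i n) ` (walk t A i n ` spc A i) = walk t B i n ` (\<phi> i ` spc A i)"
    using transforms_walk[OF assms] by (auto simp: image_image)
  then show ?thesis using transforms_bij[OF assms(1,3)] by (simp add: bij_betw_def)
qed

lemma top_equiv_walk_image_homeomorphism:
  assumes \<phi>: "transforms t \<phi> A B" "closed_cycle t A" and i: "i \<in> {1..t}"
    and hom: "homeomorphism (spc A (vtx t i n)) (spc B (vtx t i n)) (\<phi> (vtx t i n)) \<psi>"
  shows "homeomorphism (walk t A i n ` spc A i) (walk t B i n ` spc B i) (\<phi> (vtx t i n)) \<psi>"
proof (rule homeomorphism_of_subsets[OF hom])
  show "walk t A i n ` spc A i \<subseteq> spc A (vtx t i n)" using walk_closed[OF \<phi>(2) i] by blast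
qed (rule subset_refl, rule top_equiv_walk_image[OF \<phi> i])

text \<open>A walk with at least as many steps as the longest string has basis vectors annihilates the
  strings and has the regular part as its image. If its length is also a
  multiple of \<open>t\<close>, it returns to its starting vertex. Hence the homeomorphism at each vertex
  restricts to one between the regular parts.\<close>

lemma regular_part_top_equiv:
  fixes R :: "('i, 'a::real_normed_field) lcycle" and R' :: "('j, 'a) lcycle"
  assumes t: "t \<ge> 1" and R: "lin_cycle t R" "regular_cycle t R" and R': "lin_cycle t R'" "regular_cycle t R'"
    and equiv: "top_equiv_cycles t (dsum R (strings t r p L)) (dsum R' (strings t r' p' L'))"
  shows "top_equiv_cycles t R R'"
proof -
  let ?D = "dsum R (strings t r p L)" and ?D' = "dsum R' (strings t r' p' L')"
  obtain \<phi> where \<phi>: "transforms t \<phi> ?D ?D'"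
      "\<forall>i\<in>{1..t}. \<exists>\<psi>. homeomorphism (spc ?D i) (spc ?D' i) (\<phi> i) \<psi>"
    using equiv by (auto simp: top_equiv_cycles_def)
  have closed: "closed_cycle t ?D"
    by (intro dsum_closed lin_cycle_closed R closed_strings)
  \<comment> \<open>a multiple of the cycle length beyond the length of every string\<close>
  define N where "N = (\<Sum>k\<in>{1..r}. L k) + (\<Sum>k\<in>{1..r'}. L' k)"
  have "L k \<le> N" if "k \<in> {1..r}" for k
    using member_le_sum[of k "{1..r}" L] that by (simp add: N_def)
  moreover have "L' k \<le> N" if "k \<in> {1..r'}" for k
    using member_le_sum[of k "{1..r'}" L'] that by (simp add: N_def)
  moreover have "N \<le> N * t" using t by simp
  ultimately have long: "k \<in> {1..r} \<Longrightarrow> L k \<le> N * t" "k \<in> {1..r'} \<Longrightarrow> L' k \<le> N * t" for k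
    using le_trans by blast+
  have ends0: "ends t r p L i (N * t) = {}" "ends t r' p' L' i (N * t) = {}" for i
    using long by (fastforce simp: ends_def)+
  have sup0: "supported_on {} = {0 :: nat \<times> nat \<Rightarrow> 'a}" by (auto simp: supported_on_def)
  have img: "walk t ?D i (N * t) ` spc ?D i = {y. lpart y \<in> spc R i \<and> rpart y = 0}"
    "walk t ?D' i (N * t) ` spc ?D' i = {y. lpart y \<in> spc R' i \<and> rpart y = 0}" if "i \<in> {1..t}" for i
    using walk_image_regular_strings[OF R(2) that, of r p L "N * t"]
      walk_image_regular_strings[OF R'(2) that, of r' p' L' "N * t"] vtx_mult[OF that, of N]
    by (simp_all add: ends0 sup0)
  define \<theta> where "\<theta> i u = lpart (\<phi> i (join u 0))" for i u
  have hom: "\<exists>\<psi>. homeomorphism {y. lpart y \<in> spc R i \<and> rpart y = 0}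
      {y. lpart y \<in> spc R' i \<and> rpart y = 0} (\<phi> i) \<psi>" if i: "i \<in> {1..t}" for i
  proof -
    obtain \<psi> where "homeomorphism (spc ?D i) (spc ?D' i) (\<phi> i) \<psi>" using \<phi>(2) i by blast
    then show ?thesis
      using top_equiv_walk_image_homeomorphism[OF \<phi>(1) closed i, of "N * t" \<psi>] vtx_mult[OF i, of N] img[OF i]
      by auto
  qed
  have \<theta>_hom: "\<exists>\<psi>. homeomorphism (spc R i) (spc R' i) (\<theta> i) \<psi>" if i: "i \<in> {1..t}" for i
  proof -
    obtain \<psi> where h: "homeomorphism {y. lpart y \<in> spc R i \<and> rpart y = 0}
      {y. lpart y \<in> spc R' i \<and> rpart y = 0} (\<phi> i) \<psi>" using hom[OF i] by blast
    note hD = h[unfolded homeomorphism_def]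
    have \<phi>_mem: "lpart (\<phi> i y) \<in> spc R' i" "rpart (\<phi> i y) = 0" if "lpart y \<in> spc R i" "rpart y = 0" for y
      using hD that by blast+
    have \<psi>_mem: "lpart (\<psi> y) \<in> spc R i" "rpart (\<psi> y) = 0" if "lpart y \<in> spc R' i" "rpart y = 0" for y
      using hD that by blast+
    have join0: "join (lpart y) 0 = y" if "rpart y = 0" for y :: "'k + nat \<times> nat \<Rightarrow> 'a"
      using that by (intro sum_type_fun_eqI) simp_all
    have "homeomorphism (spc R i) (spc R' i) (\<theta> i) (\<lambda>u. lpart (\<psi> (join u 0)))"
    proof (rule homeomorphismI)
      have "continuous_on (spc R i) (\<lambda>u. \<phi> i (join u 0))"
        by (rule continuous_on_compose2[of _ "\<phi> i"])
          (use hD in \<open>auto intro!: continuous_on_join continuous_on_id continuous_on_const\<close>)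
      then show "continuous_on (spc R i) (\<theta> i)"
        unfolding \<theta>_def by (rule continuous_on_compose2[OF continuous_on_parts(1)]) (rule subset_UNIV)
      have "continuous_on (spc R' i) (\<lambda>u. \<psi> (join u 0))"
        by (rule continuous_on_compose2[of _ \<psi>])
          (use hD in \<open>auto intro!: continuous_on_join continuous_on_id continuous_on_const\<close>)
      then show "continuous_on (spc R' i) (\<lambda>u. lpart (\<psi> (join u 0)))"
        by (rule continuous_on_compose2[OF continuous_on_parts(1)]) (rule subset_UNIV)
      show "\<theta> i ` spc R i \<subseteq> spc R' i" unfolding \<theta>_def using \<phi>_mem by auto
      show "(\<lambda>u. lpart (\<psi> (join u 0))) ` spc R' i \<subseteq> spc R i" using \<psi>_mem by auto
      show "lpart (\<psi> (join (\<theta> i u) 0)) = u" if "u \<in> spc R i" for u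
      proof -
        have "join (\<theta> i u) 0 = \<phi> i (join u 0)" unfolding \<theta>_def by (rule join0) (simp add: \<phi>_mem that)
        moreover have "\<psi> (\<phi> i (join u 0)) = join u 0" using hD that by simp
        ultimately show ?thesis by simp
      qed
      show "\<theta> i (lpart (\<psi> (join u 0))) = u" if "u \<in> spc R' i" for u
      proof -
        have "join (lpart (\<psi> (join u 0))) 0 = \<psi> (join u 0)" by (rule join0) (simp add: \<psi>_mem that)
        moreover have "\<phi> i (\<psi> (join u 0)) = join u 0" using hD that by simp
        ultimately show ?thesis by (simp add: \<theta>_def)
      qed
    qed
    then show ?thesis by blast
  qed
  have "transforms t \<theta> R R'"
    unfolding transforms_def
  proof (intro ballI conjI)
    fix i assume i: "i \<in> {1..t}"
    show "bij_betw (\<theta> i) (spc R i) (spc R' i)"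
    proof -
      obtain \<psi> where "homeomorphism (spc R i) (spc R' i) (\<theta> i) \<psi>" using \<theta>_hom[OF i] by blast
      then show ?thesis
        by (intro bij_betw_byWitness[where f' = \<psi>]) (auto simp: homeomorphism_def)
    qed
    fix u assume u: "u \<in> spc R i"
    have "0 \<in> spc (strings t r p L :: (nat \<times> nat, 'a) lcycle) i" by (simp add: mem_spc_strings)
    then have "join u 0 \<in> spc ?D i" using u by (simp add: dsum_simps)
    then have "\<phi> (next_vertex t i) (mp ?D i (join u 0)) = mp ?D' i (\<phi> i (join u 0))"
      using \<phi>(1) i by (simp add: transforms_def)
    then have "\<phi> (next_vertex t i) (join (mp R i u) 0) = mp ?D' i (\<phi> i (join u 0))"
      by (simp add: dsum_simps mp_strings_zero)
    then show "\<theta> (next_vertex t i) (mp R i u) = mp R' i (\<theta> i u)"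
      by (simp add: \<theta>_def dsum_simps)
  qed
  then show ?thesis unfolding top_equiv_cycles_def using \<theta>_hom by blast
qed

text \<open>The image of a walk is homeomorphic to the space of functions on the pivots of the regular
  part together with the ends of the walk. Invariance of dimension compares the number of these
  coordinates on both sides; the pivots of the regular parts cancel, again by invariance of
  dimension.\<close>

lemma card_ends_invariant:
  fixes R :: "('i, 'a::{real_normed_field, euclidean_space}) lcycle" and R' :: "('j, 'a) lcycle"
  assumes t: "t \<ge> 1" and R: "lin_cycle t R" "regular_cycle t R" and R': "lin_cycle t R'" "regular_cycle t R'"
    and equiv: "top_equiv_cycles t (dsum R (strings t r p L)) (dsum R' (strings t r' p' L'))"
    and i: "i \<in> {1..t}"
  shows "card (ends t r p L i n) = card (ends t r' p' L' i n)"
proof -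
  let ?D = "dsum R (strings t r p L)" and ?D' = "dsum R' (strings t r' p' L')"
  let ?j = "vtx t i n" and ?Q = "ends t r p L i n" and ?Q' = "ends t r' p' L' i n"
  have j: "?j \<in> {1..t}" by (rule vtx_in[OF i])
  obtain \<phi> \<psi> where \<phi>: "transforms t \<phi> ?D ?D'" "homeomorphism (spc ?D ?j) (spc ?D' ?j) (\<phi> ?j) \<psi>"
    using equiv j unfolding top_equiv_cycles_def by blast
  have closed: "closed_cycle t ?D"
    by (intro dsum_closed lin_cycle_closed R closed_strings)
  obtain J where J: "finite J" "spc R ?j homeomorphic (supported_on J :: ('i \<Rightarrow> 'a) set)"
    using homeomorphic_supported_onE[OF lin_cycleD(1)[OF R(1) j]] .
  obtain J' where J': "finite J'" "spc R' ?j homeomorphic (supported_on J' :: ('j \<Rightarrow> 'a) set)"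
    using homeomorphic_supported_onE[OF lin_cycleD(1)[OF R'(1) j]] .
  have "spc R ?j homeomorphic spc R' ?j"
    using regular_part_top_equiv[OF t R R' equiv] j unfolding top_equiv_cycles_def homeomorphic_def by blast
  then have "(supported_on J :: ('i \<Rightarrow> 'a) set) homeomorphic (supported_on J' :: ('j \<Rightarrow> 'a) set)"
    by (rule homeomorphic_trans[OF homeomorphic_trans[OF J(2)[THEN homeomorphic_sym[THEN iffD1]]] J'(2)])
  then have JJ': "card J = card J'"
    by (rule supported_on_homeomorphic_imp_card_eq[OF J(1) J'(1)])
  have "{y. lpart y \<in> spc R ?j \<and> rpart y \<in> supported_on ?Q} homeomorphic
      {y. lpart y \<in> spc R' ?j \<and> rpart y \<in> supported_on ?Q'}"
    using top_equiv_walk_image_homeomorphism[OF \<phi>(1) closed i \<phi>(2)]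
    unfolding walk_image_regular_strings[OF R(2) i] walk_image_regular_strings[OF R'(2) i] homeomorphic_def
    by blast
  then have "(supported_on (J <+> ?Q) :: ('i + nat \<times> nat \<Rightarrow> 'a) set) homeomorphic
      (supported_on (J' <+> ?Q') :: ('j + nat \<times> nat \<Rightarrow> 'a) set)"
    by (rule homeomorphic_trans[OF homeomorphic_trans[OF
          homeomorphic_dsum_coordinates[OF J(2), THEN homeomorphic_sym[THEN iffD1]]]
          homeomorphic_dsum_coordinates[OF J'(2)]])
  then have "card (J <+> ?Q) = card (J' <+> ?Q')"
    by (rule supported_on_homeomorphic_imp_card_eq[rotated 2]) (use J J' finite_ends in auto)
  then show ?thesis using JJ' J(1) J'(1) by (simp add: card_Plus finite_ends)
qed

section \<open>Recovering the strings from the dimensions\<close>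

definition starts :: "nat \<Rightarrow> (nat \<Rightarrow> nat) \<Rightarrow> (nat \<Rightarrow> nat) \<Rightarrow> nat \<Rightarrow> nat \<Rightarrow> nat set" where
  "starts r p L i n = {k \<in> {1..r}. p k = i \<and> n < L k}"

text \<open>An \<open>n\<close>-step walk inside a string either starts in its first basis vector or extends backwards
  to a walk of \<open>Suc n\<close> steps with the same end.\<close>

lemma card_ends_recursion:
  assumes p: "\<And>k. k \<in> {1..r} \<Longrightarrow> p k \<in> {1..t}" and j: "j \<in> {1..t}"
  shows "card (ends t r p L (next_vertex t j) n) =
    card (starts r p L (next_vertex t j) n) + card (ends t r p L j (Suc n))"
proof -
  let ?i = "next_vertex t j"
  have "ends t r p L ?i n = (\<lambda>k. (k, n)) ` starts r p L ?i n \<union> ends t r p L j (Suc n)"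
  proof (rule Set.set_eqI)
    fix c :: "nat \<times> nat"
    obtain k q where c: "c = (k, q)" by fastforce
    consider "q < n" | "q = n" | d where "q = Suc (n + d)"
      by (metis less_imp_Suc_add linorder_neqE_nat)
    then show "c \<in> ends t r p L ?i n \<longleftrightarrow>
        c \<in> (\<lambda>k. (k, n)) ` starts r p L ?i n \<union> ends t r p L j (Suc n)"
    proof cases
      case 3
      have "next_vertex t (vtx t (p k) d) = ?i \<longleftrightarrow> vtx t (p k) d = j" if "k \<in> {1..r}"
        using next_vertex_inj[OF vtx_in[OF p[OF that]] j] by blast
      then show ?thesis unfolding c 3 by (auto simp: ends_def starts_def Suc_diff_le)
    qed (auto simp: c ends_def starts_def)
  qed
  moreover have "(\<lambda>k. (k, n)) ` starts r p L ?i n \<inter> ends t r p L j (Suc n) = {}"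
    by (auto simp: ends_def)
  moreover have "card ((\<lambda>k. (k, n)) ` starts r p L ?i n) = card (starts r p L ?i n)"
    by (rule card_image) (auto simp: inj_on_def)
  moreover have "finite (starts r p L ?i n)" by (simp add: starts_def)
  ultimately show ?thesis by (simp add: card_Un_disjoint finite_ends)
qed

text \<open>Differences of the numbers of ends count the strings with a given first vertex and more than
  \<open>n\<close> basis vectors; differences of these in turn count the strings of exact length.\<close>

lemma card_strings_eq:
  assumes p: "\<And>k. k \<in> {1..r} \<Longrightarrow> p k \<in> {1..t}" "\<And>k. k \<in> {1..r'} \<Longrightarrow> p' k \<in> {1..t}"
    and ends: "\<And>i n. i \<in> {1..t} \<Longrightarrow> card (ends t r p L i n) = card (ends t r' p' L' i n)"
    and pos: "\<And>k. k \<in> {1..r} \<Longrightarrow> 0 < L k" "\<And>k. k \<in> {1..r'} \<Longrightarrow> 0 < L' k"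
  shows "card {k \<in> {1..r}. (p k, L k) = c} = card {k \<in> {1..r'}. (p' k, L' k) = c}"
proof -
  obtain i l where c: "c = (i, l)" by fastforce
  show ?thesis
  proof (cases "i \<in> {1..t} \<and> 0 < l")
    case False
    then have "{k \<in> {1..r}. (p k, L k) = c} = {}" "{k \<in> {1..r'}. (p' k, L' k) = c} = {}"
      using p pos c by fastforce+
    then show ?thesis by (simp only: card.empty)
  next
    case True
    then obtain m where m: "l = Suc m" using gr0_conv_Suc by blast
    obtain j where j: "j \<in> {1..t}" "next_vertex t j = i" using True next_vertex_surj by blast
    have starts: "card (starts r p L i n) = card (starts r' p' L' i n)" for n
      using card_ends_recursion[where r=r and p=p and L=L and t=t and j=j and n=n, OF p(1) j(1)]
        card_ends_recursion[where r=r' and p=p' and L=L' and t=t and j=j and n=n, OF p(2) j(1)]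
        ends[of i n] ends[OF j(1), of "Suc n"] True unfolding j(2) by simp
    have split: "card (starts s q M i m) = card {k \<in> {1..s}. (q k, M k) = c} + card (starts s q M i l)" for s q M
    proof -
      have "starts s q M i m = {k \<in> {1..s}. (q k, M k) = c} \<union> starts s q M i l"
        by (auto simp: starts_def c m)
      moreover have "{k \<in> {1..s}. (q k, M k) = c} \<inter> starts s q M i l = {}"
        by (auto simp: starts_def c)
      moreover have "finite (starts s q M i l)" by (simp add: starts_def)
      ultimately show ?thesis by (simp add: card_Un_disjoint)
    qed
    show ?thesis using split[of r p L] split[of r' p' L'] starts[of m] starts[of l] by simp
  qed
qed

lemma bij_betw_equal_fibres:
  assumes "finite A" "finite B" and fib: "\<And>c. card {x \<in> A. f x = c} = card {y \<in> B. g y = c}"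
  obtains \<sigma> where "bij_betw \<sigma> A B" "\<And>x. x \<in> A \<Longrightarrow> g (\<sigma> x) = f x"
proof -
  have "\<exists>h. bij_betw h {x \<in> A. f x = c} {y \<in> B. g y = c}" for c
    using assms by (intro finite_same_card_bij) auto
  then obtain h where h: "\<And>c. bij_betw (h c) {x \<in> A. f x = c} {y \<in> B. g y = c}" by metis
  define \<sigma> where "\<sigma> x = h (f x) x" for x
  have \<sigma>: "\<sigma> x \<in> B" "g (\<sigma> x) = f x" if "x \<in> A" for x
    using bij_betw_apply[OF h[of "f x"], of x] that by (auto simp: \<sigma>_def)
  have "bij_betw \<sigma> A B"
    unfolding bij_betw_def
  proof
    show "inj_on \<sigma> A"
    proof (rule inj_onI)
      fix x y assume xy: "x \<in> A" "y \<in> A" "\<sigma> x = \<sigma> y"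
      then have "f x = f y" using \<sigma>(2) by metis
      then show "x = y"
        using bij_betw_imp_inj_on[OF h[of "f x"]] xy by (auto simp: \<sigma>_def inj_on_def)
    qed
    show "\<sigma> ` A = B"
    proof
      show "\<sigma> ` A \<subseteq> B" using \<sigma>(1) by blast
      show "B \<subseteq> \<sigma> ` A"
      proof
        fix y assume "y \<in> B"
        then have "y \<in> h (g y) ` {x \<in> A. f x = g y}"
          using bij_betw_imp_surj_on[OF h[of "g y"]] by simp
        then obtain x where "x \<in> A" "f x = g y" "y = h (g y) x" by blast
        then have "y = \<sigma> x" "x \<in> A" by (simp_all add: \<sigma>_def)
        then show "y \<in> \<sigma> ` A" by blast
      qed
    qed
  qed
  then show ?thesis using that \<sigma>(2) by blast
qed

section \<open>Topological invariance of the regularizing decomposition\<close>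

text \<open>Replacing each indecomposable singular summand by an isomorphic string makes the direct sum
  explicit.\<close>

lemma regularizing_decomposition_strings:
  fixes A :: "('i, 'a::real_normed_field) lcycle" and S :: "nat \<Rightarrow> (nat, 'a) lcycle"
  assumes "regularizing_decomposition t A R r S"
  obtains p L where "\<And>k. k \<in> {1..r} \<Longrightarrow> p k \<in> {1..t}" "\<And>k. k \<in> {1..r} \<Longrightarrow> 0 < L k"
    "\<And>k. k \<in> {1..r} \<Longrightarrow> isomorphic_cycles t (string_cycle t (p k) (L k)) (S k)"
    "isomorphic_cycles t A (dsum R (strings t r p L))"
proof -
  have S: "lin_cycle t (S k)" "indecomposable_cycle t (S k)" "singular_cycle t (S k)" if "k \<in> {1..r}" for k
    using assms that by (auto simp: regularizing_decomposition_def)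
  have "\<exists>c. fst c \<in> {1..t} \<and> 0 < snd c \<and> isomorphic_cycles t (string_cycle t (fst c) (snd c)) (S k)"
    if k: "k \<in> {1..r}" for k
  proof -
    obtain N where N: "\<And>i x. i \<in> {1..t} \<Longrightarrow> x \<in> spc (S k) i \<Longrightarrow> walk t (S k) i N x = 0"
      using indecomposable_singular_nilpotent[OF S[OF k]] by metis
    obtain i l where "i \<in> {1..t}" "0 < l" "isomorphic_cycles t (string_cycle t i l) (S k)"
      using indecomposable_nilpotent_string[OF S(1,2)[OF k] N] by metis
    then show ?thesis by (intro exI[of _ "(i, l)"]) simp
  qed
  then obtain c where c: "\<And>k. k \<in> {1..r} \<Longrightarrow> fst (c k) \<in> {1..t} \<and> 0 < snd (c k) \<and>
      isomorphic_cycles t (string_cycle t (fst (c k)) (snd (c k))) (S k)"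
    by metis
  have "isomorphic_cycles t (S k) (string_cycle t (fst (c k)) (snd (c k)))" if "k \<in> {1..r}" for k
    using c[OF that]
    by (intro isomorphic_cycles_sym[OF _ lin_cycleD(2)[OF lin_cycle_string] lin_cycle_closed[OF lin_cycle_string]])
      auto
  then have "isomorphic_cycles t (dsum R (dsum_family r S)) (dsum R (strings t r (fst \<circ> c) (snd \<circ> c)))"
    unfolding strings_def comp_def by (intro isomorphic_dsum isomorphic_cycles_refl isomorphic_dsum_family)
  then have "isomorphic_cycles t A (dsum R (strings t r (fst \<circ> c) (snd \<circ> c)))"
    using assms isomorphic_cycles_trans unfolding regularizing_decomposition_def by blast
  then show ?thesis using that[of "fst \<circ> c" "snd \<circ> c"] c by auto
qed

text \<open>Both cycles may be replaced by the direct sums of their regular parts and strings. There the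
  regular parts are topologically equivalent and each type of string occurs equally often on both
  sides, so a bijection of the summands that respects the types exists.\<close>

lemma coord_cycle_regularization_invariant:
  fixes A B :: "(nat, 'a::{real_normed_field, euclidean_space}) lcycle"
    and S S' :: "nat \<Rightarrow> (nat, 'a) lcycle"
  assumes t: "t \<ge> 1" and coord: "coord_cycle t m A" "coord_cycle t n B" and equiv: "top_equiv_cycles t A B"
    and RS: "regularizing_decomposition t A R r S" and RS': "regularizing_decomposition t B R' s S'"
  shows "top_equiv_cycles t R R' \<and> r = s \<and>
    (\<exists>\<sigma>. bij_betw \<sigma> {1..r} {1..s} \<and> (\<forall>k\<in>{1..r}. isomorphic_cycles t (S k) (S' (\<sigma> k))))"
proof -
  have A: "lin_cycle t A" and B: "lin_cycle t B" using coord by (simp_all add: coord_cycle_def)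
  obtain p L where p: "\<And>k. k \<in> {1..r} \<Longrightarrow> p k \<in> {1..t}" "\<And>k. k \<in> {1..r} \<Longrightarrow> 0 < L k"
    "\<And>k. k \<in> {1..r} \<Longrightarrow> isomorphic_cycles t (string_cycle t (p k) (L k)) (S k)"
    "isomorphic_cycles t A (dsum R (strings t r p L))"
    using regularizing_decomposition_strings[OF RS] by metis
  obtain p' L' where p': "\<And>k. k \<in> {1..s} \<Longrightarrow> p' k \<in> {1..t}" "\<And>k. k \<in> {1..s} \<Longrightarrow> 0 < L' k"
    "\<And>k. k \<in> {1..s} \<Longrightarrow> isomorphic_cycles t (string_cycle t (p' k) (L' k)) (S' k)"
    "isomorphic_cycles t B (dsum R' (strings t s p' L'))"
    using regularizing_decomposition_strings[OF RS'] by metis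
  have R: "lin_cycle t R" "regular_cycle t R" and R': "lin_cycle t R'" "regular_cycle t R'"
    using RS RS' by (auto simp: regularizing_decomposition_def)
  have "top_equiv_cycles t (dsum R (strings t r p L)) A"
    by (rule top_equiv_cycles_sym[OF isomorphic_imp_top_equiv[OF p(4) A] lin_cycle_closed[OF A]])
  then have D: "top_equiv_cycles t (dsum R (strings t r p L)) (dsum R' (strings t s p' L'))"
    by (rule top_equiv_cycles_trans[OF top_equiv_cycles_trans[OF _ equiv] isomorphic_imp_top_equiv[OF p'(4) B]])
  have "card {k \<in> {1..r}. (p k, L k) = c} = card {k \<in> {1..s}. (p' k, L' k) = c}" for c
    using p(1,2) p'(1,2) card_ends_invariant[OF t R R' D] by (intro card_strings_eq[where t = t])
  then obtain \<sigma> where \<sigma>: "bij_betw \<sigma> {1..r} {1..s}"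
      "\<And>k. k \<in> {1..r} \<Longrightarrow> (p' (\<sigma> k), L' (\<sigma> k)) = (p k, L k)"
    using bij_betw_equal_fibres[of "{1..r}" "{1..s}" "\<lambda>k. (p k, L k)" "\<lambda>k. (p' k, L' k)"] by auto
  have "isomorphic_cycles t (S k) (S' (\<sigma> k))" if k: "k \<in> {1..r}" for k
  proof (rule isomorphic_cycles_trans)
    show "isomorphic_cycles t (S k) (string_cycle t (p k) (L k))"
      by (rule isomorphic_cycles_sym[OF p(3)[OF k] lin_cycleD(2)[OF lin_cycle_string]
            lin_cycle_closed[OF lin_cycle_string]])
    show "isomorphic_cycles t (string_cycle t (p k) (L k)) (S' (\<sigma> k))"
      using p'(3)[OF bij_betw_apply[OF \<sigma>(1) k]] \<sigma>(2)[OF k] by simp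
  qed
  moreover have "r = s" using bij_betw_same_card[OF \<sigma>(1)] by simp
  ultimately show ?thesis using regular_part_top_equiv[OF t R R' D] \<sigma>(1) by blast
qed

section \<open>Regular cycles\<close>

lemma map_product_walk: "k \<le> t \<Longrightarrow> map_product (mp A) k x = walk t A 1 k x"
proof (induction k)
  case (Suc k)
  then show ?case using vtx_from_1[of k t] by simp
qed simp

lemma vtx_1_pred: "i \<in> {1..t} \<Longrightarrow> vtx t 1 (i - 1) = i"
  using vtx_from_1[of "i - 1" t] by auto

text \<open>Walks of a regular cycle are linear bijections between any two of its spaces, hence homeomorphisms.\<close>

lemma regular_coord_dims_eq:
  fixes A :: "(nat, 'a::{real_normed_field, euclidean_space}) lcycle"
  assumes A: "coord_cycle t m A" "regular_cycle t A" and i: "i \<in> {1..t}"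
  shows "m i = m 1"
proof -
  have 1: "1 \<in> {1..t}" using i by simp
  have lin: "lin_cycle t A" using A by (simp add: coord_cycle_def)
  have "homeomorphism (spc A 1) (spc A (vtx t 1 (i - 1))) (walk t A 1 (i - 1))
      (inv_into (spc A 1) (walk t A 1 (i - 1)))"
    by (rule linear_bijection_homeomorphism[OF lin_cycleD(1)[OF lin 1] walk_linear[OF lin 1]
          regular_walk_bij[OF A(2) 1]])
  then have "spc A 1 homeomorphic spc A i"
    unfolding vtx_1_pred[OF i] homeomorphic_def by blast
  then have "(supported_on {..<m 1} :: (nat \<Rightarrow> 'a) set) homeomorphic (supported_on {..<m i} :: (nat \<Rightarrow> 'a) set)"
    using A(1) i 1 by (simp add: coord_cycle_def coord_space_eq_supported)
  from supported_on_homeomorphic_imp_card_eq[OF _ _ this] show ?thesis by simp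
qed

lemma coord_normal_cycle:
  fixes A :: "(nat, 'a::{real_normed_field, euclidean_space}) lcycle"
  assumes A: "coord_cycle t m A" "regular_cycle t A"
  shows "coord_cycle t m (normal_cycle t A)"
proof -
  have lin: "lin_cycle t A" using A by (simp add: coord_cycle_def)
  have spc1: "spc A i = spc A 1" if i: "i \<in> {1..t}" for i
  proof -
    have "1 \<in> {1..t}" using i by simp
    then show ?thesis
      using A(1) i regular_coord_dims_eq[OF A i] unfolding coord_cycle_def by simp
  qed
  have "linear_map_on (spc A i) (spc A (next_vertex t i)) (mp (normal_cycle t A) i)" if i: "i \<in> {1..t}" for i
  proof (cases "i = t")
    case True
    have 1: "1 \<in> {1..t}" using i by simp
    have "linear_map_on (spc A 1) (spc A 1) (walk t A 1 t)"
      using walk_linear[OF lin 1, of t] vtx_period[OF 1] by simp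
    moreover have "mp (normal_cycle t A) i = walk t A 1 t"
      using True map_product_walk[of t t A] by (simp add: normal_cycle_def fun_eq_iff)
    ultimately show ?thesis
      using spc1[OF i] spc1[OF next_vertex_in[OF i]] by simp
  next
    case False
    then show ?thesis
      using spc1[OF i] spc1[OF next_vertex_in[OF i]]
      by (simp add: normal_cycle_def linear_map_on_def)
  qed
  then show ?thesis using A(1) by (auto simp: coord_cycle_def lin_cycle_def normal_cycle_def)
qed

text \<open>The isomorphism from the normal form is given by the partial products \<open>A\<^sub>i\<^sub>-\<^sub>1 \<dots> A\<^sub>1\<close>: then
  all mappings but the last one become identities, and the last one absorbs the whole product.\<close>

lemma isomorphic_normal_cycle:
  fixes A :: "(nat, 'a::{real_normed_field, euclidean_space}) lcycle"
  assumes A: "coord_cycle t m A" "regular_cycle t A"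
  shows "isomorphic_cycles t A (normal_cycle t A)"
proof -
  let ?N = "normal_cycle t A"
  have lin: "lin_cycle t A" using A by (simp add: coord_cycle_def)
  have linN: "lin_cycle t ?N" using coord_normal_cycle[OF A] by (simp add: coord_cycle_def)
  define \<theta> where "\<theta> i = walk t A 1 (i - 1)" for i
  have spcN: "spc ?N i = spc A 1" if i: "i \<in> {1..t}" for i
  proof -
    have "1 \<in> {1..t}" using i by simp
    then show ?thesis
      using A(1) i regular_coord_dims_eq[OF A i] unfolding coord_cycle_def normal_cycle_def by simp
  qed
  have "transforms t \<theta> ?N A"
    unfolding transforms_def
  proof (intro ballI conjI)
    fix i assume i: "i \<in> {1..t}"
    then have 1: "1 \<in> {1..t}" by simp
    show "bij_betw (\<theta> i) (spc ?N i) (spc A i)"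
      using regular_walk_bij[OF A(2) 1, of "i - 1"] unfolding \<theta>_def spcN[OF i] vtx_1_pred[OF i] .
    have step: "mp A i (\<theta> i x) = walk t A 1 i x" for x
    proof -
      obtain n where n: "i = Suc n" using i by (cases i) auto
      have "vtx t 1 n = i" using vtx_1_pred[OF i] n by simp
      then show ?thesis unfolding \<theta>_def n by simp
    qed
    show "\<theta> (next_vertex t i) (mp ?N i x) = mp A i (\<theta> i x)" for x
    proof (cases "i = t")
      case True
      have "\<theta> (next_vertex t i) (mp ?N i x) = map_product (mp A) t x"
        using True by (simp add: \<theta>_def normal_cycle_def next_vertex_def)
      also have "\<dots> = walk t A 1 t x" by (rule map_product_walk) simp
      finally show ?thesis using step[of x] True by simp
    next
      case False
      have "\<theta> (next_vertex t i) (mp ?N i x) = walk t A 1 i x"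
        using False by (simp add: \<theta>_def normal_cycle_def next_vertex_def)
      then show ?thesis using step by simp
    qed
  qed
  moreover have "linear_map_on (spc ?N i) (spc A i) (\<theta> i)" if i: "i \<in> {1..t}" for i
  proof -
    have 1: "1 \<in> {1..t}" using i by simp
    show ?thesis
      using walk_linear[OF lin 1, of "i - 1"] unfolding \<theta>_def spcN[OF i] vtx_1_pred[OF i] .
  qed
  ultimately have "isomorphic_cycles t ?N A" unfolding isomorphic_cycles_def by blast
  then show ?thesis
    by (rule isomorphic_cycles_sym[OF _ lin_cycleD(2)[OF linN] lin_cycle_closed[OF linN]])
qed

lemma regular_cycle_normal_form:
  fixes A :: "(nat, 'a::{real_normed_field, euclidean_space}) lcycle"
  assumes "coord_cycle t m A" "regular_cycle t A"
  shows "(\<forall>i\<in>{1..t}. m i = m 1) \<and>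
    coord_cycle t m (normal_cycle t A) \<and> isomorphic_cycles t A (normal_cycle t A)"
  using regular_coord_dims_eq[OF assms] coord_normal_cycle[OF assms] isomorphic_normal_cycle[OF assms]
  by blast

lemma transforms_operator_cycle:
  "transforms 1 \<phi> (operator_cycle V f) (operator_cycle W g) \<longleftrightarrow>
    bij_betw (\<phi> 1) V W \<and> (\<forall>x\<in>V. \<phi> 1 (f x) = g (\<phi> 1 x))"
  by (auto simp: transforms_def operator_cycle_def next_vertex_def)

text \<open>A transformation of regular cycles restricts at vertex \<open>1\<close> to one of the return maps.
  Conversely, a conjugacy of the return maps, used at every vertex, transforms the normal forms
  into each other, and these are isomorphic to the given cycles.\<close>

lemma regular_top_equiv_iff:
  fixes A B :: "(nat, 'a::{real_normed_field, euclidean_space}) lcycle"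
  assumes t: "t \<ge> 1" and A: "coord_cycle t m A" "regular_cycle t A"
    and B: "coord_cycle t n B" "regular_cycle t B"
  shows "top_equiv_cycles t A B \<longleftrightarrow>
    top_equiv_cycles 1 (operator_cycle (coord_space (m 1)) (map_product (mp A) t))
      (operator_cycle (coord_space (n 1)) (map_product (mp B) t))"
proof
  have 1: "1 \<in> {1..t}" using t by simp
  have lin: "lin_cycle t A" "lin_cycle t B" using A B by (simp_all add: coord_cycle_def)
  have spc: "spc A i = coord_space (m 1)" "spc B i = coord_space (n 1)" if "i \<in> {1..t}" for i
    using A(1) B(1) that regular_coord_dims_eq[OF A that] regular_coord_dims_eq[OF B that]
    by (simp_all add: coord_cycle_def)
  let ?f = "map_product (mp A) t" and ?g = "map_product (mp B) t"
  {
    assume "top_equiv_cycles t A B"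
    then obtain \<phi> where \<phi>: "transforms t \<phi> A B"
        "\<forall>i\<in>{1..t}. \<exists>\<psi>. homeomorphism (spc A i) (spc B i) (\<phi> i) \<psi>"
      by (auto simp: top_equiv_cycles_def)
    have "\<phi> 1 (?f x) = ?g (\<phi> 1 x)" if "x \<in> coord_space (m 1)" for x
      using transforms_walk[OF \<phi>(1) lin_cycle_closed[OF lin(1)] 1, of x t] that spc(1)[OF 1]
        map_product_walk[of t t A] map_product_walk[of t t B] vtx_period[OF 1] by simp
    then have "transforms 1 \<phi> (operator_cycle (coord_space (m 1)) ?f) (operator_cycle (coord_space (n 1)) ?g)"
      unfolding transforms_operator_cycle using transforms_bij[OF \<phi>(1) 1] spc[OF 1] by simp
    moreover have "\<exists>\<psi>. homeomorphism (coord_space (m 1)) (coord_space (n 1)) (\<phi> 1) \<psi>"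
      using \<phi>(2) 1 spc[OF 1] by metis
    ultimately show "top_equiv_cycles 1 (operator_cycle (coord_space (m 1)) ?f)
        (operator_cycle (coord_space (n 1)) ?g)"
      unfolding top_equiv_cycles_def by (intro exI[of _ \<phi>]) (simp add: operator_cycle_def)
  }
  {
    assume "top_equiv_cycles 1 (operator_cycle (coord_space (m 1)) ?f) (operator_cycle (coord_space (n 1)) ?g)"
    then obtain \<phi> where \<phi>: "transforms 1 \<phi> (operator_cycle (coord_space (m 1)) ?f) (operator_cycle (coord_space (n 1)) ?g)"
        "\<exists>\<psi>. homeomorphism (coord_space (m 1)) (coord_space (n 1)) (\<phi> 1) \<psi>"
      by (auto simp: top_equiv_cycles_def operator_cycle_def)
    have "transforms t (\<lambda>_. \<phi> 1) (normal_cycle t A) (normal_cycle t B)"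
      using \<phi>(1) spc unfolding transforms_operator_cycle
      by (simp add: transforms_def normal_cycle_def)
    then have "top_equiv_cycles t (normal_cycle t A) (normal_cycle t B)"
      unfolding top_equiv_cycles_def using \<phi>(2) spc
      by (intro exI[of _ "\<lambda>_. \<phi> 1"]) (simp add: normal_cycle_def)
    moreover have "top_equiv_cycles t A (normal_cycle t A)" "top_equiv_cycles t B (normal_cycle t B)"
      using isomorphic_imp_top_equiv[OF isomorphic_normal_cycle[OF A] lin(1)]
        isomorphic_imp_top_equiv[OF isomorphic_normal_cycle[OF B] lin(2)] .
    ultimately show "top_equiv_cycles t A B"
      using top_equiv_cycles_trans top_equiv_cycles_sym lin_cycle_closed[OF lin(2)] by meson
  }
qed

theorem theorem1:
  fixes t :: nat
  assumes "t \<ge> 1"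
  shows
    "(\<forall>m n (A :: (nat, complex) lcycle) (B :: (nat, complex) lcycle)
        (R :: (nat, complex) lcycle) r (S :: nat \<Rightarrow> (nat, complex) lcycle)
        (R' :: (nat, complex) lcycle) s (S' :: nat \<Rightarrow> (nat, complex) lcycle).
        coord_cycle t m A \<longrightarrow> coord_cycle t n B \<longrightarrow> top_equiv_cycles t A B \<longrightarrow>
        regularizing_decomposition t A R r S \<longrightarrow>
        regularizing_decomposition t B R' s S' \<longrightarrow>
        top_equiv_cycles t R R' \<and> r = s \<and>
        (\<exists>\<sigma>. bij_betw \<sigma> {1..r} {1..s} \<and>
             (\<forall>k\<in>{1..r}. isomorphic_cycles t (S k) (S' (\<sigma> k))))) \<and>
     (\<forall>m n (A :: (nat, real) lcycle) (B :: (nat, real) lcycle)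
        (R :: (nat, real) lcycle) r (S :: nat \<Rightarrow> (nat, real) lcycle)
        (R' :: (nat, real) lcycle) s (S' :: nat \<Rightarrow> (nat, real) lcycle).
        coord_cycle t m A \<longrightarrow> coord_cycle t n B \<longrightarrow> top_equiv_cycles t A B \<longrightarrow>
        regularizing_decomposition t A R r S \<longrightarrow>
        regularizing_decomposition t B R' s S' \<longrightarrow>
        top_equiv_cycles t R R' \<and> r = s \<and>
        (\<exists>\<sigma>. bij_betw \<sigma> {1..r} {1..s} \<and>
             (\<forall>k\<in>{1..r}. isomorphic_cycles t (S k) (S' (\<sigma> k))))) \<and>
     (\<forall>m (A :: (nat, complex) lcycle).
        coord_cycle t m A \<longrightarrow> regular_cycle t A \<longrightarrow>
        (\<forall>i\<in>{1..t}. m i = m 1) \<and>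
        coord_cycle t m (normal_cycle t A) \<and> isomorphic_cycles t A (normal_cycle t A)) \<and>
     (\<forall>m n (A :: (nat, complex) lcycle) (B :: (nat, complex) lcycle).
        coord_cycle t m A \<longrightarrow> coord_cycle t n B \<longrightarrow>
        regular_cycle t A \<longrightarrow> regular_cycle t B \<longrightarrow>
        (top_equiv_cycles t A B \<longleftrightarrow>
         top_equiv_cycles 1 (operator_cycle (coord_space (m 1)) (map_product (mp A) t))
                            (operator_cycle (coord_space (n 1)) (map_product (mp B) t)))) \<and>
     (\<forall>m (A :: (nat, real) lcycle).
        coord_cycle t m A \<longrightarrow> regular_cycle t A \<longrightarrow>
        (\<forall>i\<in>{1..t}. m i = m 1) \<and>
        coord_cycle t m (normal_cycle t A) \<and> isomorphic_cycles t A (normal_cycle t A)) \<and>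
     (\<forall>m n (A :: (nat, real) lcycle) (B :: (nat, real) lcycle).
        coord_cycle t m A \<longrightarrow> coord_cycle t n B \<longrightarrow>
        regular_cycle t A \<longrightarrow> regular_cycle t B \<longrightarrow>
        (top_equiv_cycles t A B \<longleftrightarrow>
         top_equiv_cycles 1 (operator_cycle (coord_space (m 1)) (map_product (mp A) t))
                            (operator_cycle (coord_space (n 1)) (map_product (mp B) t))))"
  by (intro conjI; intro allI impI;
      rule coord_cycle_regularization_invariant[OF assms] regular_cycle_normal_form
        regular_top_equiv_iff[OF assms]; assumption)

end
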